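(* Let $0\le a<b$, let $n\ge 1$, and let $\mathcal F_1,\dots,\mathcal F_n$ be i.i.d. distributions with support $\{a,b\}$ (support size $2$), with $\mathcal F=\mathcal F_1\times\cdots\times\mathcal F_n$. Then there is an integer $k\in\{0,1,\dots,n\}$ such that the discounted item-pricing in which the grand bundle $[n]$ is priced at $kb+(n-k)a$ and each individual item is priced at $b$ has expected revenue equal to $\mathrm{Rev}(\mathcal F)$, the optimal expected revenue of a lottery-pricing. Moreover, such a $k$ can be found in polynomial time given $\mathcal F$.
   Context: A seller sells $n$ items to one additive buyer whose valuation vector $v=(v_1,\dots,v_n)$ is drawn from $\mathcal F=\mathcal F_1\times\cdots\times\mathcal F_n$, where each $\mathcal F_i$ is a finitely supported distribution on nonnegative (rational) values, given explicitly by listing its support and its (rational) probabilities. Let $D$ be the set of valuation vectors in the support of $\mathcal F$. $\mathrm{Rev}(\mathcal F)$ is the optimal value of the linear program that maximizes $\sum_{v\in D}\pi_v\Pr[v]$ over $x_v\in[0,1]^n$ and $\pi_v\in\mathbb R$ ($v\in D$) subject to $\sum_i v_i x_{v,i}-\pi_v\ge 0$ for all $v\in D$, and $\sum_i w_i x_{w,i}-\pi_w\ge\sum_i w_i x_{v,i}-\pi_v$ for all $v,w\in D$. A discounted item-pricing is given by prices $\pi_1,\dots,\pi_n$ for the individual items and a price $\pi$ for the grand bundle $[n]$. With valuation $v$, the buyer buys either the grand bundle at price $\pi$, or any subset $T\subseteq[n]$ at price $\sum_{i\in T}\pi_i$ (possibly $T=\emptyset$ at price $0$), choosing an option that maximizes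 her utility (total value of the items received minus price paid); ties in utility are broken in favor of higher price. The expected revenue is the expectation over $v\sim\mathcal F$ of the price paid. *)

theory Defs
  imports
    "HOL-Probability.Probability"
    "HOL-Probability.Product_PMF"
    "HOL-Computational_Algebra.Polynomial"
    "HOL-Library.Log_Nat"
begin

section \<open>Value distributions and the lottery-pricing linear program\<close>

text \<open>Items are indexed by \<open>{..<n}\<close>. A valuation vector is a function that vanishes outside
  \<open>{..<n}\<close>, so that \<open>valuations n F\<close> is finite when all marginals have finite support.\<close>

definition value_dist :: "real pmf \<Rightarrow> bool" where
  "value_dist G \<longleftrightarrow> finite (set_pmf G) \<and> (\<forall>v\<in>set_pmf G. 0 \<le> v \<and> v \<in> \<rat> \<and> pmf G v \<in> \<rat>)"

definition prior :: "nat \<Rightarrow> (nat \<Rightarrow> real pmf) \<Rightarrow> (nat \<Rightarrow> real) pmf" where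
  "prior n F = Pi_pmf {..<n} 0 F"

definition valuations :: "nat \<Rightarrow> (nat \<Rightarrow> real pmf) \<Rightarrow> (nat \<Rightarrow> real) set" where
  "valuations n F = set_pmf (prior n F)"

text \<open>\<open>x v i\<close> is the probability that a buyer reporting \<open>v\<close> receives item \<open>i\<close>,
  and \<open>p v\<close> is the price of her lottery.\<close>

definition lottery_utility ::
    "nat \<Rightarrow> ((nat \<Rightarrow> real) \<Rightarrow> nat \<Rightarrow> real) \<Rightarrow> ((nat \<Rightarrow> real) \<Rightarrow> real) \<Rightarrow>
     (nat \<Rightarrow> real) \<Rightarrow> (nat \<Rightarrow> real) \<Rightarrow> real" where
  "lottery_utility n x p w v = (\<Sum>i<n. w i * x v i) - p v"

definition feasible_lottery ::
    "nat \<Rightarrow> (nat \<Rightarrow> real pmf) \<Rightarrow> ((nat \<Rightarrow> real) \<Rightarrow> nat \<Rightarrow> real) \<Rightarrow> ((nat \<Rightarrow> real) \<Rightarrow> real) \<Rightarrow> bool" where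
  "feasible_lottery n F x p \<longleftrightarrow>
     (\<forall>v\<in>valuations n F. \<forall>i<n. 0 \<le> x v i \<and> x v i \<le> 1) \<and>
     (\<forall>v\<in>valuations n F. lottery_utility n x p v v \<ge> 0) \<and>
     (\<forall>v\<in>valuations n F. \<forall>w\<in>valuations n F.
        lottery_utility n x p w w \<ge> lottery_utility n x p w v)"

text \<open>The feasible set contains the zero lottery, and by individual rationality the objective
  is bounded, so this supremum is the optimal value of the linear program.\<close>

definition Rev :: "nat \<Rightarrow> (nat \<Rightarrow> real pmf) \<Rightarrow> real" where
  "Rev n F = Sup {\<Sum>v\<in>valuations n F. p v * pmf (prior n F) v | x p. feasible_lottery n F x p}"

section \<open>Discounted item-pricings\<close>

datatype purchase = Grand_Bundle | Items "nat set"

definition purchases :: "nat \<Rightarrow> purchase set" where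
  "purchases n = insert Grand_Bundle (Items ` Pow {..<n})"

fun received :: "nat \<Rightarrow> purchase \<Rightarrow> nat set" where
  "received n Grand_Bundle = {..<n}"
| "received n (Items T) = T"

fun price :: "(nat \<Rightarrow> real) \<Rightarrow> real \<Rightarrow> purchase \<Rightarrow> real" where
  "price ip gp Grand_Bundle = gp"
| "price ip gp (Items T) = (\<Sum>i\<in>T. ip i)"

definition utility :: "nat \<Rightarrow> (nat \<Rightarrow> real) \<Rightarrow> real \<Rightarrow> (nat \<Rightarrow> real) \<Rightarrow> purchase \<Rightarrow> real" where
  "utility n ip gp v o' = (\<Sum>i\<in>received n o'. v i) - price ip gp o'"

definition favourites :: "nat \<Rightarrow> (nat \<Rightarrow> real) \<Rightarrow> real \<Rightarrow> (nat \<Rightarrow> real) \<Rightarrow> purchase set" where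
  "favourites n ip gp v =
     {c \<in> purchases n. \<forall>d\<in>purchases n. utility n ip gp v d \<le> utility n ip gp v c}"

text \<open>Taking the maximum breaks ties in utility in favour of the higher price.\<close>

definition price_paid :: "nat \<Rightarrow> (nat \<Rightarrow> real) \<Rightarrow> real \<Rightarrow> (nat \<Rightarrow> real) \<Rightarrow> real" where
  "price_paid n ip gp v = Max (price ip gp ` favourites n ip gp v)"

definition discounted_revenue :: "nat \<Rightarrow> (nat \<Rightarrow> real pmf) \<Rightarrow> (nat \<Rightarrow> real) \<Rightarrow> real \<Rightarrow> real" where
  "discounted_revenue n F ip gp =
     measure_pmf.expectation (prior n F) (price_paid n ip gp)"

section \<open>Polynomial time\<close>

text \<open>The machine model is the random access machine of Aho, Hopcroft and Ullman under the
  logarithmic cost criterion, which is polynomially equivalent to Turing machines; the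
  deviations, none of which affects polynomial time, are structured control flow,
  three-address instructions instead of an accumulator, natural-number cells (with truncated
  subtraction) and output in cell 0. There is a read-only input tape and an unbounded memory
  of cells, initially all zero, with direct and indirect addressing. An operation is charged
  the bit lengths of all addresses it uses and of all its operands.\<close>

definition len :: "nat \<Rightarrow> nat" where
  "len k = max 1 (floorlog 2 k)"

datatype loc = Cell nat | At nat
datatype operand = Const nat | Val loc
datatype arith = Plus | Minus | Times | Divide

datatype com =
    Skip
  | Read loc
  | Op loc arith operand operand
  | Seq com com
  | If_Pos operand com com
  | While_Pos operand com

type_synonym memory = "nat \<Rightarrow> nat"
type_synonym state = "memory \<times> nat list"

fun addr :: "memory \<Rightarrow> loc \<Rightarrow> nat" where
  "addr m (Cell i) = i"
| "addr m (At i) = m i"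

fun loc_cost :: "memory \<Rightarrow> loc \<Rightarrow> nat" where
  "loc_cost m (Cell i) = len i"
| "loc_cost m (At i) = len i + len (m i)"

fun oval :: "memory \<Rightarrow> operand \<Rightarrow> nat" where
  "oval m (Const c) = c"
| "oval m (Val l) = m (addr m l)"

fun ocost :: "memory \<Rightarrow> operand \<Rightarrow> nat" where
  "ocost m (Const c) = len c"
| "ocost m (Val l) = loc_cost m l + len (m (addr m l))"

fun apply_arith :: "arith \<Rightarrow> nat \<Rightarrow> nat \<Rightarrow> nat" where
  "apply_arith Plus x y = x + y"
| "apply_arith Minus x y = x - y"
| "apply_arith Times x y = x * y"
| "apply_arith Divide x y = x div y"

text \<open>\<open>run c s t s'\<close>: started in state \<open>s\<close> (memory and unread input), program \<open>c\<close> halts in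
  state \<open>s'\<close> at total cost \<open>t\<close>.\<close>

inductive run :: "com \<Rightarrow> state \<Rightarrow> nat \<Rightarrow> state \<Rightarrow> bool" where
  Skip: "run Skip s 1 s"
| Read: "run (Read l) (m, z # zs) (loc_cost m l + len z) (m(addr m l := z), zs)"
| Read_End: "run (Read l) (m, []) (loc_cost m l + len 0) (m(addr m l := 0), [])"
| Op: "run (Op l f y z) (m, zs) (loc_cost m l + ocost m y + ocost m z)
         (m(addr m l := apply_arith f (oval m y) (oval m z)), zs)"
| Seq: "run c s t s' \<Longrightarrow> run d s' u s'' \<Longrightarrow> run (Seq c d) s (t + u) s''"
| If_True: "oval m y > 0 \<Longrightarrow> run c (m, zs) t s' \<Longrightarrow> run (If_Pos y c d) (m, zs) (ocost m y + t) s'"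
| If_False: "oval m y = 0 \<Longrightarrow> run d (m, zs) t s' \<Longrightarrow> run (If_Pos y c d) (m, zs) (ocost m y + t) s'"
| While_False: "oval m y = 0 \<Longrightarrow> run (While_Pos y c) (m, zs) (ocost m y) (m, zs)"
| While_True: "oval m y > 0 \<Longrightarrow> run c (m, zs) t s' \<Longrightarrow> run (While_Pos y c) s' u s'' \<Longrightarrow>
    run (While_Pos y c) (m, zs) (ocost m y + t + u) s''"

lemma run_deterministic: "run c s t s' \<Longrightarrow> run c s u s'' \<Longrightarrow> t = u \<and> s' = s''"
proof (induction arbitrary: u s'' rule: run.induct)
  case (Skip s) from Skip.prems show ?case by cases simp
next
  case (Read l m z zs) from Read.prems show ?case by cases simp
next
  case (Read_End l m) from Read_End.prems show ?case by cases simp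
next
  case (Op l f y z m zs) from Op.prems show ?case by cases simp
next
  case (Seq c s t s1 d u1 s2)
  from Seq.prems show ?case
  proof cases
    case inner: (Seq t' s1' u')
    have "t = t' \<and> s1 = s1'" by (rule Seq.IH(1)) fact
    moreover from this have "u1 = u' \<and> s2 = s''" by (intro Seq.IH(2)) (use inner(3) in simp)
    ultimately show ?thesis using inner(1) by simp
  qed
next
  case (If_True m y c zs t s' d)
  from If_True.prems show ?case
  proof cases
    case inner: (If_True t')
    have "t = t' \<and> s' = s''" by (rule If_True.IH) fact
    then show ?thesis using inner(1) by simp
  next
    case If_False
    then show ?thesis using If_True.hyps(1) by simp
  qed
next
  case (If_False m y d zs t s' c)
  from If_False.prems show ?case
  proof cases
    case inner: (If_False t')
    have "t = t' \<and> s' = s''" by (rule If_False.IH) fact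
    then show ?thesis using inner(1) by simp
  next
    case If_True
    then show ?thesis using If_False.hyps(1) by simp
  qed
next
  case (While_False m y c zs)
  from While_False.prems show ?case
    by cases (use While_False.hyps(1) in simp_all)
next
  case (While_True m y c zs t s1 u1 s2)
  from While_True.prems show ?case
  proof cases
    case While_False
    then show ?thesis using While_True.hyps(1) by simp
  next
    case inner: (While_True t' s1' u')
    have "t = t' \<and> s1 = s1'" by (rule While_True.IH(1)) fact
    moreover from this have "u1 = u' \<and> s2 = s''" by (intro While_True.IH(2)) (use inner(4) in simp)
    ultimately show ?thesis using inner(1) by simp
  qed
qed

definition computes_within :: "com \<Rightarrow> nat list \<Rightarrow> nat \<Rightarrow> nat \<Rightarrow> bool" where
  "computes_within c inp T k \<longleftrightarrow> (\<exists>t m zs. run c (\<lambda>_. 0, inp) t (m, zs) \<and> t \<le> T \<and> m 0 = k)"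

definition input_size :: "nat list \<Rightarrow> nat" where
  "input_size inp = sum_list (map len inp)"

subsection \<open>Explicit presentation of the input\<close>

text \<open>\<open>xs\<close> lists every support point of \<open>G\<close> once, in any order, with its probability.\<close>

definition listing :: "(rat \<times> rat) list \<Rightarrow> real pmf \<Rightarrow> bool" where
  "listing xs G \<longleftrightarrow>
     distinct (map fst xs) \<and>
     of_rat ` fst ` set xs = set_pmf G \<and>
     (\<forall>(v, p)\<in>set xs. pmf G (of_rat v) = of_rat p)"

text \<open>All rationals in a listing are nonnegative, so reduced numerators and denominators are
  natural numbers.\<close>

definition encode_rat :: "rat \<Rightarrow> nat list" where
  "encode_rat r = [nat (fst (quotient_of r)), nat (snd (quotient_of r))]"

definition encode_listing :: "(rat \<times> rat) list \<Rightarrow> nat list" where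
  "encode_listing xs = length xs # concat (map (\<lambda>(v, p). encode_rat v @ encode_rat p) xs)"

definition encode_instance :: "(rat \<times> rat) list list \<Rightarrow> nat list" where
  "encode_instance xss = length xss # concat (map encode_listing xss)"

section \<open>Two-point i.i.d. instances\<close>

definition iid_two_point :: "real \<Rightarrow> real \<Rightarrow> nat \<Rightarrow> (nat \<Rightarrow> real pmf) \<Rightarrow> bool" where
  "iid_two_point a b n F \<longleftrightarrow>
     0 \<le> a \<and> a < b \<and> n \<ge> 1 \<and>
     (\<forall>i<n. value_dist (F i) \<and> set_pmf (F i) = {a, b}) \<and>
     (\<forall>i<n. \<forall>j<n. F i = F j)"

end

(* Write s for the number of high items, P_s for its probability and d = b - a. In a feasible
   lottery the utility of a type S is at least that of S - {i} plus d times the probability that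
   S - {i} receives the item i. Averaging over the types with equally many high items, the average
   utility at level s is at least d (X_0 + ... + X_{s-1}), where X_t is the average probability that
   a low item is sold at level t. Hence the revenue is at most
   sum_s P_s s b + sum_{t<n} X_t ((n - t) a P_t - d Pr[s > t]). The coefficient of X_t has the sign of
   a - d V_t with V_t = Pr[s > t] / ((n - t) P_t), and the recursion
   V_t = r / (t + 1) (1 + (n - t - 1) V_{t+1}), where r is the odds of a high value, shows that V_t
   decreases in t. So the bound is largest when X_t = 1 exactly for t \<ge> k, and this value is the
   revenue of the discounted item-pricing with threshold k. The recursion, run on unreduced
   fractions of polynomial bit length, also computes k. *)
theory Submission imports Defs begin

section \<open>The optimal pricing\<close>

text \<open>With \<open>r\<close> the odds of a high value, \<open>odds_tail r n (n - t)\<close> is the ratio of \<open>Pr[s > t]\<close> to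
  \<open>(n - t) Pr[s = t]\<close>, where \<open>s\<close> is the number of high items.\<close>

primrec odds_tail :: "real \<Rightarrow> nat \<Rightarrow> nat \<Rightarrow> real" where
  "odds_tail r n 0 = 0"
| "odds_tail r n (Suc j) = r / real (n - j) * (1 + real j * odds_tail r n j)"

section \<open>Monotone tail ratios and the threshold search\<close>

lemma odds_tail_nonneg: "0 \<le> r \<Longrightarrow> 0 \<le> odds_tail r n j"
  by (induction j) auto

text \<open>Induction: from one step to the next \<open>r / real (n - j)\<close> grows because its
  divisor shrinks, and the bracket grows by the induction hypothesis. The bound
  \<open>Suc j \<le> n\<close> keeps the divisors positive.\<close>

lemma odds_tail_Suc_mono:
  assumes "0 \<le> r" "Suc j \<le> n"
  shows "odds_tail r n j \<le> odds_tail r n (Suc j)"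
  using assms(2)
proof (induction j)
  case 0
  then show ?case using assms(1) by simp
next
  case (Suc j)
  have "r / real (n - j) * (1 + real j * odds_tail r n j)
      \<le> r / real (n - Suc j) * (1 + real (Suc j) * odds_tail r n (Suc j))"
  proof (intro mult_mono add_mono divide_left_mono)
    show "odds_tail r n j \<le> odds_tail r n (Suc j)" using Suc by simp
  qed (use Suc.prems assms(1) odds_tail_nonneg[OF assms(1)] in \<open>auto simp del: odds_tail.simps\<close>)
  then show ?case by (simp only: odds_tail.simps)
qed

lemma odds_tail_mono:
  assumes "0 \<le> r" "i \<le> j" "j \<le> n"
  shows "odds_tail r n i \<le> odds_tail r n j"
  using assms(2,3)
proof (induction j rule: dec_induct)
  case (step j)
  then show ?case using odds_tail_Suc_mono[OF assms(1), of j n] by linarith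
qed simp

text \<open>The index \<open>j\<close> counts low items, so a larger \<open>j\<close> means a lower
  threshold \<open>n - j\<close>. A later success overrides earlier ones, just as the loop of the
  program overwrites its candidate; \<open>n\<close> remains when no test succeeds.\<close>

primrec cutoff :: "(nat \<Rightarrow> bool) \<Rightarrow> nat \<Rightarrow> nat \<Rightarrow> nat" where
  "cutoff T n 0 = n"
| "cutoff T n (Suc j) = (if T (Suc j) then n - Suc j else cutoff T n j)"

lemma cutoff_le: "cutoff T n j \<le> n"
  by (induction j) auto

lemma cutoff_ge: "n - j \<le> cutoff T n j"
  by (induction j) auto

text \<open>Antitone tests succeed on an initial segment, so the last success, which fixes the
  result, decides all smaller indices. The index 0 is never tested, hence
  \<open>1 \<le> i\<close>.\<close>

lemma cutoff_le_iff:
  assumes anti: "\<And>i j. i \<le> j \<Longrightarrow> j \<le> n \<Longrightarrow> T j \<Longrightarrow> T i"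
    and "1 \<le> i" "i \<le> j" "j \<le> n"
  shows "cutoff T n j \<le> n - i \<longleftrightarrow> T i"
  using assms(3,4)
proof (induction j)
  case 0
  then show ?case using assms(2) by simp
next
  case (Suc j)
  show ?case
  proof (cases "T (Suc j)")
    case True
    then show ?thesis using anti[of i "Suc j"] Suc.prems by auto
  next
    case False
    show ?thesis
    proof (cases "i = Suc j")
      case True
      have "n - Suc j < cutoff T n j" using cutoff_ge[of n j T] Suc.prems by linarith
      then show ?thesis using False True by auto
    next
      case ne: False
      then show ?thesis using Suc False by auto
    qed
  qed
qed

section \<open>Counting on the levels of the subset lattice\<close>

lemma sum_subsets_by_card:
  "(\<Sum>S\<in>Pow {..<n::nat}. f S) = (\<Sum>s\<le>n. \<Sum>S | S \<subseteq> {..<n} \<and> card S = s. f S)"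
proof -
  have "card ` Pow {..<n} \<subseteq> {..n}"
    by (auto intro: card_mono[of "{..<n}", simplified])
  from sum.group[OF _ _ this, of f] show ?thesis by (simp add: Pow_def)
qed

text \<open>Both sides range over the edges of the subset lattice between the levels \<open>s\<close> and
  \<open>s + 1\<close>.\<close>

lemma sum_lattice_edges:
  "(\<Sum>S | S \<subseteq> {..<n::nat} \<and> card S = Suc s. \<Sum>i\<in>S. f (S - {i}) i) =
   (\<Sum>S | S \<subseteq> {..<n} \<and> card S = s. \<Sum>i\<in>{..<n} - S. f S i)"
proof -
  have fin: "finite S" if "S \<subseteq> {..<n}" for S using that finite_subset by blast
  have "(\<Sum>(S, i)\<in>Sigma {S. S \<subseteq> {..<n} \<and> card S = Suc s} (\<lambda>S. S). f (S - {i}) i) =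
        (\<Sum>(S, i)\<in>Sigma {S. S \<subseteq> {..<n} \<and> card S = s} (\<lambda>S. {..<n} - S). f S i)"
    by (rule sum.reindex_bij_witness[where i = "\<lambda>(S, i). (insert i S, i)"
          and j = "\<lambda>(S, i). (S - {i}, i)"])
       (auto simp: insert_absorb card_insert_if dest: fin)
  then show ?thesis by (subst (asm) (1 2) sum.Sigma[symmetric]) (auto dest: fin)
qed

lemma Suc_times_binomial_real:
  "real (Suc s) * real (n choose Suc s) = real (n - s) * real (n choose s)"
proof -
  have "Suc s * (n choose Suc s) = (n - s) * (n choose s)"
    by (simp only: binomial_absorption binomial_absorb_comp)
  then show ?thesis by (metis of_nat_mult)
qed

lemma feasible_lottery_utility_step:
  assumes "feasible_lottery n F x p" "v \<in> valuations n F" "w \<in> valuations n F"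
  shows "lottery_utility n x p w w \<ge> lottery_utility n x p v v + (\<Sum>i<n. (w i - v i) * x v i)"
proof -
  have "lottery_utility n x p w w \<ge> lottery_utility n x p w v"
    using assms by (simp add: feasible_lottery_def)
  also have "lottery_utility n x p w v = lottery_utility n x p v v + (\<Sum>i<n. (w i - v i) * x v i)"
    by (simp add: lottery_utility_def left_diff_distrib sum_subtractf)
  finally show ?thesis .
qed

section \<open>The distribution of the number of high items\<close>

locale two_point_iid =
  fixes a b :: real and n :: nat and F :: "nat \<Rightarrow> real pmf"
  assumes iid: "iid_two_point a b n F"
begin

definition "high_prob = pmf (F 0) b"
definition "low_prob = pmf (F 0) a"
definition "odds = high_prob / low_prob"

text \<open>The value 0 outside \<open>{..<n}\<close> is the default value of \<open>prior\<close>,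
  so the profiles of subsets of \<open>{..<n}\<close> are precisely its support.\<close>

definition profile :: "nat set \<Rightarrow> nat \<Rightarrow> real" where
  "profile S i = (if i < n then if i \<in> S then b else a else 0)"

definition level_prob :: "nat \<Rightarrow> real" where
  "level_prob s = real (n choose s) * (high_prob ^ s * low_prob ^ (n - s))"

lemma a_nonneg: "0 \<le> a" and a_less_b: "a < b" and n_pos: "1 \<le> n"
  and set_pmf_F: "i < n \<Longrightarrow> set_pmf (F i) = {a, b}"
  using iid unfolding iid_two_point_def by blast+

lemma F_eq: "i < n \<Longrightarrow> F i = F 0"
  using iid n_pos unfolding iid_two_point_def by (metis less_le_trans zero_less_one)

lemma high_prob_pos: "0 < high_prob" and low_prob_pos: "0 < low_prob"
  using set_pmf_F[of 0] n_pos
  by (auto simp: high_prob_def low_prob_def pmf_positive)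

lemma odds_pos: "0 < odds"
  by (simp add: odds_def high_prob_pos low_prob_pos)

lemma level_prob_pos: "s \<le> n \<Longrightarrow> 0 < level_prob s"
  by (simp add: level_prob_def high_prob_pos low_prob_pos)

lemma valuations_eq: "valuations n F = profile ` Pow {..<n}"
proof -
  have "valuations n F = {f. \<forall>i. (i \<in> {..<n} \<longrightarrow> f i \<in> {a, b}) \<and> (i \<notin> {..<n} \<longrightarrow> f i = 0)}"
    by (auto simp: valuations_def prior_def set_Pi_pmf PiE_dflt_def set_pmf_F)
  also have "\<dots> = profile ` Pow {..<n}"
  proof (intro equalityI subsetI)
    fix f assume f: "f \<in> {f. \<forall>i. (i \<in> {..<n} \<longrightarrow> f i \<in> {a, b}) \<and> (i \<notin> {..<n} \<longrightarrow> f i = 0)}"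
    have "f = profile {i. i < n \<and> f i = b}"
    proof
      fix i show "f i = profile {i. i < n \<and> f i = b} i"
        using f by (auto simp: profile_def)
    qed
    then show "f \<in> profile ` Pow {..<n}" by blast
  qed (auto simp: profile_def)
  finally show ?thesis .
qed

lemma profile_in_valuations: "S \<subseteq> {..<n} \<Longrightarrow> profile S \<in> valuations n F"
  by (auto simp: valuations_eq)

lemma inj_on_profile: "inj_on profile (Pow {..<n})"
proof (rule inj_onI)
  fix S T assume ST: "S \<in> Pow {..<n}" "T \<in> Pow {..<n}" "profile S = profile T"
  have "i \<in> S \<longleftrightarrow> i \<in> T" if "i < n" for i
    using fun_cong[OF ST(3), of i] that a_less_b by (auto simp: profile_def split: if_splits)
  then show "S = T" using ST(1,2) by blast
qed

lemma pmf_profile: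
  assumes "S \<subseteq> {..<n}"
  shows "pmf (prior n F) (profile S) = high_prob ^ card S * low_prob ^ (n - card S)"
proof -
  have "pmf (prior n F) (profile S) = (\<Prod>i<n. pmf (F i) (profile S i))"
    unfolding prior_def by (rule pmf_Pi') (auto simp: profile_def)
  also have "\<dots> = (\<Prod>i<n. if i \<in> S then high_prob else low_prob)"
  proof (rule prod.cong)
    fix i assume "i \<in> {..<n}"
    moreover from this have "F i = F 0" by (intro F_eq) simp
    ultimately show "pmf (F i) (profile S i) = (if i \<in> S then high_prob else low_prob)"
      by (simp add: profile_def high_prob_def low_prob_def)
  qed simp
  also have "\<dots> = (\<Prod>i\<in>S. high_prob) * (\<Prod>i\<in>{..<n} - S. low_prob)"
    using assms by (subst prod.If_cases) (auto simp: Int_absorb1 Diff_eq)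
  also have "\<dots> = high_prob ^ card S * low_prob ^ (n - card S)"
    using assms by (simp add: card_Diff_subset finite_subset)
  finally show ?thesis .
qed

text \<open>The probability of a profile depends only on the number of high items and leaves the
  inner sum; \<open>f\<close> stays inside, since an arbitrary lottery may treat the types of one
  level differently.\<close>

lemma sum_valuations:
  "(\<Sum>v\<in>valuations n F. f v * pmf (prior n F) v) =
   (\<Sum>s\<le>n. (high_prob ^ s * low_prob ^ (n - s)) *
      (\<Sum>S | S \<subseteq> {..<n} \<and> card S = s. f (profile S)))"
proof -
  have "(\<Sum>v\<in>valuations n F. f v * pmf (prior n F) v) =
        (\<Sum>S\<in>Pow {..<n}. f (profile S) * pmf (prior n F) (profile S))"
    unfolding valuations_eq by (subst sum.reindex[OF inj_on_profile]) simp
  also have "\<dots> = (\<Sum>s\<le>n. (high_prob ^ s * low_prob ^ (n - s)) *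
      (\<Sum>S | S \<subseteq> {..<n} \<and> card S = s. f (profile S)))"
    unfolding sum_subsets_by_card sum_distrib_left
    by (intro sum.cong) (auto simp: pmf_profile)
  finally show ?thesis .
qed

lemma sum_valuations_level:
  assumes "\<And>S. S \<subseteq> {..<n} \<Longrightarrow> f (profile S) = g (card S)"
  shows "(\<Sum>v\<in>valuations n F. f v * pmf (prior n F) v) = (\<Sum>s\<le>n. level_prob s * g s)"
  unfolding sum_valuations
proof (rule sum.cong)
  fix s
  have "(\<Sum>S | S \<subseteq> {..<n} \<and> card S = s. f (profile S)) = (\<Sum>S | S \<subseteq> {..<n} \<and> card S = s. g s)"
    by (rule sum.cong) (auto simp: assms)
  then show "(high_prob ^ s * low_prob ^ (n - s)) *
      (\<Sum>S | S \<subseteq> {..<n} \<and> card S = s. f (profile S)) = level_prob s * g s"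
    by (simp add: n_subsets level_prob_def)
qed simp

subsection \<open>The threshold form of the bound\<close>

definition tail_prob :: "nat \<Rightarrow> real" where
  "tail_prob t = (\<Sum>s\<in>{t<..n}. level_prob s)"

lemma level_prob_ratio:
  assumes "s < n"
  shows "real (Suc s) * level_prob (Suc s) = odds * real (n - s) * level_prob s"
proof -
  have "n - s = Suc (n - Suc s)" using assms by simp
  then have "real (Suc s) * level_prob (Suc s) =
      (real (Suc s) * real (n choose Suc s)) * odds * (high_prob ^ s * low_prob ^ (n - s))"
    using low_prob_pos by (simp add: level_prob_def odds_def)
  then show ?thesis unfolding Suc_times_binomial_real by (simp add: level_prob_def mult_ac)
qed

text \<open>The induction runs down from the top level, where the tail is empty: peeling off level
  \<open>Suc s\<close> and expressing it through level \<open>s\<close> reproduces the recursion of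
  \<open>odds_tail\<close>.\<close>

lemma tail_prob_eq_aux:
  "j \<le> n \<Longrightarrow> tail_prob (n - j) = real j * level_prob (n - j) * odds_tail odds n j"
proof (induction j)
  case 0
  then show ?case by (simp add: tail_prob_def)
next
  case (Suc j)
  define s where "s = n - Suc j"
  have s: "n - j = Suc s" "s < n" "n - s = Suc j" using Suc.prems by (auto simp: s_def)
  have "{s<..n} = insert (Suc s) {Suc s<..n}" using s by auto
  then have "tail_prob s = level_prob (Suc s) + tail_prob (Suc s)"
    by (simp add: tail_prob_def)
  also have "\<dots> = level_prob (Suc s) * (1 + real j * odds_tail odds n j)"
    using Suc s by (simp add: algebra_simps)
  also have "level_prob (Suc s) = odds * real (n - s) * level_prob s / real (Suc s)"
    using level_prob_ratio[OF s(2)] by (simp add: field_simps)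
  finally have "tail_prob s = real (Suc j) * level_prob s *
      (odds / real (Suc s) * (1 + real j * odds_tail odds n j))"
    using s by simp
  then show ?case by (simp only: s odds_tail.simps s_def[symmetric])
qed

lemma tail_prob_eq:
  "t \<le> n \<Longrightarrow> tail_prob t = real (n - t) * level_prob t * odds_tail odds n (n - t)"
  using tail_prob_eq_aux[of "n - t"] by simp

text \<open>The effect on revenue of selling every low item at level \<open>t\<close>: an income of
  \<open>a\<close> per low item, less the utility \<open>b - a\<close> that the types on each higher
  level must then be left with on average.\<close>

definition gain :: "nat \<Rightarrow> real" where
  "gain t = real (n - t) * a * level_prob t - (b - a) * tail_prob t"

lemma gain_eq:
  "t \<le> n \<Longrightarrow> gain t = real (n - t) * level_prob t * (a - (b - a) * odds_tail odds n (n - t))"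
  by (simp add: gain_def tail_prob_eq algebra_simps)

lemma sum_level_partial_sums:
  "(\<Sum>s\<le>n. level_prob s * (\<Sum>t<s. X t)) = (\<Sum>t<n. X t * tail_prob t)"
proof -
  have "(\<Sum>s\<le>n. level_prob s * (\<Sum>t<s. X t)) =
        (\<Sum>s\<le>n. \<Sum>t\<in>{t. t < n \<and> t < s}. level_prob s * X t)"
    unfolding sum_distrib_left by (intro sum.cong) auto
  also have "\<dots> = (\<Sum>t<n. \<Sum>s\<in>{s. s \<le> n \<and> t < s}. level_prob s * X t)"
    using sum.swap_restrict[of "{..n}" "{..<n}" "\<lambda>s t. level_prob s * X t" "\<lambda>s t. t < s"] by simp
  also have "\<dots> = (\<Sum>t<n. X t * tail_prob t)"
    unfolding tail_prob_def sum_distrib_left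
    by (intro sum.cong) (auto simp: greaterThanAtMost_def mult.commute)
  finally show ?thesis .
qed

text \<open>\<open>X\<close> is arbitrary: the upper bound inserts the sale rates of a given
  lottery, the item-pricing the indicator of \<open>k \<le> t\<close>, so both revenues take the
  same form and can be compared term by term.\<close>

lemma level_revenue_eq:
  "(\<Sum>s\<le>n. level_prob s * (real s * b + real (n - s) * a * X s - (b - a) * (\<Sum>t<s. X t))) =
   (\<Sum>s\<le>n. level_prob s * (real s * b)) + (\<Sum>t<n. X t * gain t)"
proof -
  have "(\<Sum>s\<le>n. level_prob s * (real (n - s) * a * X s)) =
        (\<Sum>s<n. X s * (real (n - s) * a * level_prob s))"
    by (rule sum.mono_neutral_cong_right) auto
  moreover have "(\<Sum>s\<le>n. level_prob s * ((b - a) * (\<Sum>t<s. X t))) =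
      (b - a) * (\<Sum>t<n. X t * tail_prob t)"
    by (simp only: sum_level_partial_sums[symmetric] sum_distrib_left[of "b - a" _ "{..n}"]
        mult.left_commute[of "b - a"])
  moreover have "(\<Sum>t<n. X t * gain t) = (\<Sum>t<n. X t * (real (n - t) * a * level_prob t)) -
      (b - a) * (\<Sum>t<n. X t * tail_prob t)"
    by (simp only: gain_def right_diff_distrib[of "X _"] sum_subtractf sum_distrib_left mult.left_commute)
  ultimately show ?thesis
    by (simp only: distrib_left right_diff_distrib[of "level_prob _"] sum.distrib sum_subtractf)
qed

subsection \<open>The upper bound\<close>

text \<open>Averages over each level take the place of symmetrising the lottery. The bound is then
  linear in the rates \<open>X t\<close> in \<open>[0, 1]\<close>, and the signs of
  \<open>gain\<close> make 0 below \<open>k\<close> and 1 from \<open>k\<close> on a best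
  choice.\<close>

lemma revenue_le:
  assumes feas: "feasible_lottery n F x p"
    and k: "\<And>t. k \<le> t \<Longrightarrow> t < n \<Longrightarrow> 0 \<le> gain t" "\<And>t. t < k \<Longrightarrow> t < n \<Longrightarrow> gain t \<le> 0"
  shows "(\<Sum>v\<in>valuations n F. p v * pmf (prior n F) v) \<le>
    (\<Sum>s\<le>n. level_prob s * (real s * b)) + (\<Sum>t<n. of_bool (k \<le> t) * gain t)"
proof -
  define u where "u S = lottery_utility n x p (profile S) (profile S)" for S
  define level where "level s = {S. S \<subseteq> {..<n} \<and> card S = s}" for s
  define A where "A s = (\<Sum>S\<in>level s. u S)" for s
  define B where "B s = (\<Sum>S\<in>level s. \<Sum>i\<in>{..<n} - S. x (profile S) i)" for s
  \<comment> \<open>The divisor is the number of pairs of a type of level \<open>s\<close> and one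
    of its low items. At \<open>s = n\<close> it is 0, and so is \<open>X n\<close>;
    \<open>B_eq\<close> survives there because \<open>B n\<close> is 0 as well.\<close>
  define X where "X s = B s / (real (n - s) * real (n choose s))" for s
  have card_level: "card (level s) = n choose s" for s
    by (simp add: level_def n_subsets)
  have x01: "0 \<le> x (profile S) i" "x (profile S) i \<le> 1" if "S \<subseteq> {..<n}" "i < n" for S i
    using feas that profile_in_valuations by (auto simp: feasible_lottery_def)

  have step: "u S \<ge> u (S - {i}) + (b - a) * x (profile (S - {i})) i"
    if "S \<subseteq> {..<n}" "i \<in> S" for S i
  proof -
    have "(\<Sum>j<n. (profile S j - profile (S - {i}) j) * x (profile (S - {i})) j) =
          (\<Sum>j\<in>{i}. (b - a) * x (profile (S - {i})) i)"
      by (rule sum.mono_neutral_cong_right) (use that in \<open>auto simp: profile_def\<close>)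
    then show ?thesis
      using feasible_lottery_utility_step[OF feas profile_in_valuations profile_in_valuations,
          of "S - {i}" S] that
      by (auto simp: u_def)
  qed
  \<comment> \<open>Summing \<open>step\<close> over the edges between the two levels counts each
    upper set \<open>Suc s\<close> times and each lower set \<open>n - s\<close> times.\<close>
  have A_Suc: "real (Suc s) * A (Suc s) \<ge> real (n - s) * A s + (b - a) * B s" for s
  proof -
    have "real (Suc s) * A (Suc s) = (\<Sum>S\<in>level (Suc s). \<Sum>i\<in>S. u S)"
      unfolding A_def sum_distrib_left by (rule sum.cong) (auto simp: level_def)
    also have "\<dots> \<ge> (\<Sum>S\<in>level (Suc s). \<Sum>i\<in>S. u (S - {i}) + (b - a) * x (profile (S - {i})) i)"
      by (intro sum_mono step) (auto simp: level_def)
    also have "(\<Sum>S\<in>level (Suc s). \<Sum>i\<in>S. u (S - {i}) + (b - a) * x (profile (S - {i})) i) =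
        (\<Sum>S\<in>level s. \<Sum>i\<in>{..<n} - S. u S + (b - a) * x (profile S) i)"
      unfolding level_def by (rule sum_lattice_edges)
    also have "\<dots> = (\<Sum>S\<in>level s. real (n - s) * u S) + (b - a) * B s"
      unfolding B_def sum_distrib_left sum.distrib
      by (intro arg_cong2[where f = "(+)"] sum.cong refl)
         (auto simp: level_def card_Diff_subset finite_subset)
    finally show ?thesis by (simp add: A_def sum_distrib_left)
  qed
  have B_bounds: "0 \<le> B s" "B s \<le> real (n - s) * real (n choose s)" for s
  proof -
    show "0 \<le> B s" unfolding B_def by (intro sum_nonneg x01) (auto simp: level_def)
    have "B s \<le> (\<Sum>S\<in>level s. \<Sum>i\<in>{..<n} - S. 1)"
      unfolding B_def by (intro sum_mono x01) (auto simp: level_def)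
    also have "\<dots> = (\<Sum>S\<in>level s. real (n - s))"
      by (rule sum.cong) (auto simp: level_def card_Diff_subset finite_subset)
    finally show "B s \<le> real (n - s) * real (n choose s)"
      by (simp add: card_level mult.commute)
  qed
  have X01: "0 \<le> X s" "X s \<le> 1" for s
    unfolding X_def using B_bounds[of s] by (auto intro!: divide_nonneg_nonneg divide_le_eq_1[THEN iffD2])
  have B_eq: "B s = real (n - s) * real (n choose s) * X s" if "s \<le> n" for s
    using B_bounds[of n] that by (cases "s = n") (auto simp: X_def)

  \<comment> \<open>The base case is individual rationality of the type without high items. In the
    induction step \<open>A_Suc\<close> is divided by \<open>Suc s\<close>, the edge count
    converting the binomial coefficients.\<close>
  have A_ge: "real (n choose s) * ((b - a) * (\<Sum>t<s. X t)) \<le> A s" if "s \<le> n" for s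
    using that
  proof (induction s)
    case 0
    show ?case unfolding A_def u_def
      using feas profile_in_valuations
      by (auto simp: level_def feasible_lottery_def intro!: sum_nonneg)
  next
    case (Suc s)
    let ?c = "real (n choose s)"
    have "real (Suc s) * (real (n choose Suc s) * ((b - a) * (\<Sum>t<Suc s. X t))) =
          real (n - s) * (?c * ((b - a) * (\<Sum>t<s. X t))) + (b - a) * (real (n - s) * ?c * X s)"
      unfolding mult.assoc[symmetric] Suc_times_binomial_real by (simp add: algebra_simps)
    also have "\<dots> \<le> real (n - s) * A s + (b - a) * B s"
      using Suc B_eq[of s] a_less_b by (intro add_mono mult_left_mono) auto
    also have "\<dots> \<le> real (Suc s) * A (Suc s)" by (rule A_Suc)
    finally show ?case by (rule mult_left_le_imp_le) simp
  qed

  have level_revenue: "(\<Sum>S\<in>level s. p (profile S)) \<le> real (n choose s) *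
      (real s * b + real (n - s) * a * X s - (b - a) * (\<Sum>t<s. X t))" if "s \<le> n" for s
  proof -
    \<comment> \<open>The payment is value minus utility. High items contribute at most
      \<open>b\<close> each, low items \<open>a\<close> times their sale probability.\<close>
    have "p (profile S) \<le> real s * b + a * (\<Sum>i\<in>{..<n} - S. x (profile S) i) - u S"
      if S: "S \<in> level s" for S
    proof -
      have sub: "S \<subseteq> {..<n}" and card: "card S = s" using S by (auto simp: level_def)
      have "(\<Sum>i<n. profile S i * x (profile S) i) =
          (\<Sum>i\<in>{..<n} - S. profile S i * x (profile S) i) + (\<Sum>i\<in>S. profile S i * x (profile S) i)"
        using sub by (intro sum.subset_diff) auto
      also have "(\<Sum>i\<in>{..<n} - S. profile S i * x (profile S) i) =
          a * (\<Sum>i\<in>{..<n} - S. x (profile S) i)"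
        unfolding sum_distrib_left by (rule sum.cong) (auto simp: profile_def)
      also have "(\<Sum>i\<in>S. profile S i * x (profile S) i) \<le> (\<Sum>i\<in>S. b)"
      proof (rule sum_mono)
        fix i assume "i \<in> S"
        then have "i < n" "profile S i = b" using sub by (auto simp: profile_def)
        then show "profile S i * x (profile S) i \<le> b"
          using x01[OF sub, of i] a_nonneg a_less_b mult_left_mono[of "x (profile S) i" 1 b] by simp
      qed
      finally show ?thesis using card by (simp add: u_def lottery_utility_def)
    qed
    then have "(\<Sum>S\<in>level s. p (profile S)) \<le>
        (\<Sum>S\<in>level s. real s * b + a * (\<Sum>i\<in>{..<n} - S. x (profile S) i) - u S)"
      by (rule sum_mono)
    also have "\<dots> = real (n choose s) * (real s * b) + a * B s - A s"
      by (simp add: sum.distrib sum_subtractf A_def B_def sum_distrib_left card_level)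
    also have "\<dots> \<le> real (n choose s) * (real s * b) + a * (real (n - s) * real (n choose s) * X s)
        - real (n choose s) * ((b - a) * (\<Sum>t<s. X t))"
      using A_ge[OF that] B_eq[OF that] by simp
    finally show ?thesis by (simp add: algebra_simps)
  qed

  have "(\<Sum>v\<in>valuations n F. p v * pmf (prior n F) v) =
      (\<Sum>s\<le>n. (high_prob ^ s * low_prob ^ (n - s)) * (\<Sum>S\<in>level s. p (profile S)))"
    unfolding level_def by (rule sum_valuations)
  also have "\<dots> \<le> (\<Sum>s\<le>n. (high_prob ^ s * low_prob ^ (n - s)) * (real (n choose s) *
      (real s * b + real (n - s) * a * X s - (b - a) * (\<Sum>t<s. X t))))"
    by (intro sum_mono mult_left_mono level_revenue) (use high_prob_pos low_prob_pos in auto)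
  also have "\<dots> = (\<Sum>s\<le>n. level_prob s *
      (real s * b + real (n - s) * a * X s - (b - a) * (\<Sum>t<s. X t)))"
    by (simp add: level_prob_def mult_ac)
  also have "\<dots> = (\<Sum>s\<le>n. level_prob s * (real s * b)) + (\<Sum>t<n. X t * gain t)"
    by (rule level_revenue_eq)
  also have "\<dots> \<le> (\<Sum>s\<le>n. level_prob s * (real s * b)) + (\<Sum>t<n. of_bool (k \<le> t) * gain t)"
  proof (intro add_left_mono sum_mono)
    fix t assume "t \<in> {..<n}"
    then have t: "t < n" by simp
    show "X t * gain t \<le> of_bool (k \<le> t) * gain t"
    proof (cases "k \<le> t")
      case True
      then show ?thesis using mult_right_mono[OF X01(2) k(1)[OF True t], of t] by simp
    next
      case False
      then show ?thesis using mult_nonneg_nonpos[OF X01(1)] k(2)[of t] t by simp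
    qed
  qed
  finally show ?thesis .
qed

subsection \<open>The discounted item-pricing\<close>

definition bundle_price :: "nat \<Rightarrow> real" where
  "bundle_price k = real k * b + real (n - k) * a"

definition level_price :: "nat \<Rightarrow> nat \<Rightarrow> real" where
  "level_price k s = (if k \<le> s then bundle_price k else real s * b)"

lemma sum_profile:
  assumes "S \<subseteq> {..<n}" "T \<subseteq> {..<n}"
  shows "(\<Sum>i\<in>T. profile S i) = real (card (T \<inter> S)) * b + real (card (T - S)) * a"
proof -
  have "finite T" using assms(2) finite_subset by blast
  then have "(\<Sum>i\<in>T. profile S i) = (\<Sum>i\<in>T \<inter> S. profile S i) + (\<Sum>i\<in>T - S. profile S i)"
    by (rule sum.Int_Diff)
  also have "\<dots> = (\<Sum>i\<in>T \<inter> S. b) + (\<Sum>i\<in>T - S. a)"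
    by (intro arg_cong2[where f = "(+)"] sum.cong) (use assms in \<open>auto simp: profile_def\<close>)
  finally show ?thesis by simp
qed

text \<open>The bundle price is the value of all items to a buyer with exactly \<open>k\<close> high
  ones; each further high item adds \<open>b - a\<close>, and each missing one takes it
  away.\<close>

lemma bundle_utility:
  assumes "S \<subseteq> {..<n}" "k \<le> n"
  shows "(\<Sum>i<n. profile S i) - bundle_price k = (real (card S) - real k) * (b - a)"
proof -
  have "card S \<le> n" using card_mono[of "{..<n}" S] assms by simp
  then show ?thesis using sum_profile[of S "{..<n}"] assms
    by (simp add: bundle_price_def Int_absorb1 card_Diff_subset finite_subset of_nat_diff algebra_simps)
qed

lemma items_utility:
  assumes "S \<subseteq> {..<n}" "T \<subseteq> {..<n}"
  shows "(\<Sum>i\<in>T. profile S i) - (\<Sum>i\<in>T. b) = - real (card (T - S)) * (b - a)"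
proof -
  have "finite T" using assms(2) finite_subset by blast
  then have "card T = card (T \<inter> S) + card (T - S)" by (metis card_Int_Diff)
  then show ?thesis using sum_profile[OF assms] by (simp add: algebra_simps)
qed

text \<open>Sets of high items yield utility 0, and any low item bought singly is a loss. Below
  \<open>k\<close> high items the ties among such sets go to the full set; at exactly
  \<open>k\<close> the bundle ties with it and costs no less; above \<open>k\<close> the bundle is
  strictly better.\<close>

lemma price_paid_profile:
  assumes S: "S \<subseteq> {..<n}" and k: "k \<le> n"
  shows "price_paid n (\<lambda>_. b) (bundle_price k) (profile S) = level_price k (card S)"
proof -
  let ?u = "utility n (\<lambda>_. b) (bundle_price k) (profile S)"
  have b: "0 < b" using a_nonneg a_less_b by simp
  have u_bundle: "?u Grand_Bundle = (real (card S) - real k) * (b - a)"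
    using bundle_utility[OF S k] by (simp add: utility_def)
  have u_items: "?u (Items T) = - real (card (T - S)) * (b - a)" if "T \<subseteq> {..<n}" for T
    using items_utility[OF S that] by (simp add: utility_def)
  have u_items_le: "?u (Items T) \<le> 0" if "T \<subseteq> {..<n}" for T
    using u_items[OF that] a_less_b by simp
  have items_price: "(\<Sum>i\<in>T. b) \<le> real (card S) * b" if "T \<subseteq> {..<n}" "0 \<le> ?u (Items T)" for T
  proof -
    have "real (card (T - S)) * (b - a) \<le> 0" using u_items[OF that(1)] that(2) by simp
    then have "real (card (T - S)) \<le> 0" using a_less_b by (simp add: mult_le_0_iff)
    moreover have "finite (T - S)" using that(1) finite_subset by blast
    ultimately have "T \<subseteq> S" by auto
    moreover have "finite S" using S finite_subset by blast
    ultimately show ?thesis using b by (simp add: card_mono)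
  qed
  have "finite (price (\<lambda>_. b) (bundle_price k) ` favourites n (\<lambda>_. b) (bundle_price k) (profile S))"
    by (simp add: favourites_def purchases_def)
  then show ?thesis unfolding price_paid_def
  proof (rule Max_eqI)
    show "level_price k (card S) \<in>
        price (\<lambda>_. b) (bundle_price k) ` favourites n (\<lambda>_. b) (bundle_price k) (profile S)"
    proof (cases "k \<le> card S")
      case True
      then have "Grand_Bundle \<in> favourites n (\<lambda>_. b) (bundle_price k) (profile S)"
        using u_bundle u_items_le a_less_b
        by (auto simp: favourites_def purchases_def intro: order_trans[OF u_items_le])
      then show ?thesis using True by (force simp: level_price_def)
    next
      case False
      then have "?u Grand_Bundle \<le> 0" using u_bundle a_less_b by (simp add: mult_le_0_iff)
      moreover have "?u (Items S) = 0" using u_items[OF S] by simp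
      ultimately have "Items S \<in> favourites n (\<lambda>_. b) (bundle_price k) (profile S)"
        using u_items_le S by (auto simp: favourites_def purchases_def)
      then show ?thesis using False by (force simp: level_price_def)
    qed
  next
    fix y assume "y \<in> price (\<lambda>_. b) (bundle_price k) ` favourites n (\<lambda>_. b) (bundle_price k) (profile S)"
    then obtain c where c: "c \<in> purchases n" "y = price (\<lambda>_. b) (bundle_price k) c"
      and best: "\<And>e. e \<in> purchases n \<Longrightarrow> ?u e \<le> ?u c"
      by (auto simp: favourites_def)
    have c_bundle: "(real (card S) - real k) * (b - a) \<le> ?u c"
      using best[of Grand_Bundle] u_bundle by (simp add: purchases_def)
    have c_nonneg: "0 \<le> ?u c"
      using best[of "Items S"] u_items[OF S] S by (auto simp: purchases_def)
    show "y \<le> level_price k (card S)"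
    proof (cases c)
      case Grand_Bundle
      then have "0 \<le> (real (card S) - real k) * (b - a)" using c_nonneg u_bundle by simp
      then have "k \<le> card S" using a_less_b by (simp add: zero_le_mult_iff)
      then show ?thesis using c Grand_Bundle by (simp add: level_price_def)
    next
      case (Items T)
      then have T: "T \<subseteq> {..<n}" using c by (auto simp: purchases_def)
      have y: "y \<le> real (card S) * b" using items_price[OF T] c_nonneg c(2) Items by simp
      show ?thesis
      proof (cases "k \<le> card S")
        case True
        \<comment> \<open>Items are a best choice only if the bundle yields no positive utility,
          which leaves the tie \<open>card S = k\<close>.\<close>
        have "(real (card S) - real k) * (b - a) \<le> 0"
          using c_bundle u_items_le[OF T] Items by simp
        then have "card S \<le> k" using a_less_b by (simp add: mult_le_0_iff)
        then show ?thesis using y True a_nonneg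
          by (auto simp: level_price_def bundle_price_def intro: order_trans)
      next
        case False
        then show ?thesis using y by (simp add: level_price_def)
      qed
    qed
  qed
qed

lemma discounted_revenue_eq:
  assumes "k \<le> n"
  shows "discounted_revenue n F (\<lambda>_. b) (bundle_price k) =
    (\<Sum>s\<le>n. level_prob s * (real s * b)) + (\<Sum>t<n. of_bool (k \<le> t) * gain t)"
proof -
  have "discounted_revenue n F (\<lambda>_. b) (bundle_price k) =
      (\<Sum>v\<in>valuations n F. price_paid n (\<lambda>_. b) (bundle_price k) v * pmf (prior n F) v)"
    unfolding discounted_revenue_def
    by (subst integral_measure_pmf_real[where A = "valuations n F"])
       (auto simp: valuations_eq valuations_def[symmetric])
  also have "\<dots> = (\<Sum>s\<le>n. level_prob s * level_price k s)"
    by (rule sum_valuations_level) (rule price_paid_profile[OF _ assms])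
  \<comment> \<open>With the indicator as \<open>X\<close>, the level formula of the upper bound is
    met with equality: for \<open>k \<le> s\<close> the utility term is
    \<open>(b - a) * (s - k)\<close>.\<close>
  also have "\<dots> = (\<Sum>s\<le>n. level_prob s * (real s * b + real (n - s) * a * of_bool (k \<le> s)
      - (b - a) * (\<Sum>t<s. of_bool (k \<le> t))))"
  proof (intro sum.cong refl arg_cong2[where f = "(*)"])
    fix s assume s: "s \<in> {..n}"
    have "(\<Sum>t<s. of_bool (k \<le> t) :: real) = real (card {t. t < s \<and> k \<le> t})"
      by (simp add: sum.If_cases of_bool_def Int_def)
    also have "{t. t < s \<and> k \<le> t} = {k..<s}" by auto
    finally have "(\<Sum>t<s. of_bool (k \<le> t) :: real) = real (s - k)" by simp
    then show "level_price k s = real s * b + real (n - s) * a * of_bool (k \<le> s)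
      - (b - a) * (\<Sum>t<s. of_bool (k \<le> t))"
      using s assms by (auto simp: level_price_def bundle_price_def of_nat_diff algebra_simps)
  qed
  also have "\<dots> = (\<Sum>s\<le>n. level_prob s * (real s * b)) + (\<Sum>t<n. of_bool (k \<le> t) * gain t)"
    by (rule level_revenue_eq)
  finally show ?thesis .
qed

text \<open>The pricing becomes a direct lottery that assigns to every report its purchase and
  payment. Its revenue is thus a member of the set whose supremum is \<open>Rev\<close>.\<close>

lemma discounted_revenue_attained:
  assumes k: "k \<le> n"
  obtains x p where "feasible_lottery n F x p"
    "(\<Sum>v\<in>valuations n F. p v * pmf (prior n F) v) =
      discounted_revenue n F (\<lambda>_. b) (bundle_price k)"
proof
  define highs where "highs v = {i. i < n \<and> v i = b}" for v :: "nat \<Rightarrow> real"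
  define x :: "(nat \<Rightarrow> real) \<Rightarrow> nat \<Rightarrow> real"
    where "x v i = of_bool (k \<le> card (highs v) \<or> i \<in> highs v)" for v i
  let ?p = "price_paid n (\<lambda>_. b) (bundle_price k)"
  have highs: "highs (profile S) = S" if "S \<subseteq> {..<n}" for S
    using that a_less_b by (auto simp: highs_def profile_def split: if_splits)
  have u: "lottery_utility n x ?p (profile S) (profile T) =
      (if k \<le> card T then (real (card S) - real k) * (b - a) else - real (card (T - S)) * (b - a))"
    if S: "S \<subseteq> {..<n}" and T: "T \<subseteq> {..<n}" for S T
  proof (cases "k \<le> card T")
    case True
    then show ?thesis using bundle_utility[OF S k]
      by (simp add: lottery_utility_def x_def highs[OF T] price_paid_profile[OF T k] level_price_def)
  next
    case False
    have "(\<Sum>i<n. profile S i * x (profile T) i) = (\<Sum>i\<in>T. profile S i)"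
      by (rule sum.mono_neutral_cong_right) (use T False in \<open>auto simp: x_def highs\<close>)
    then show ?thesis using items_utility[OF S T] False
      by (simp add: lottery_utility_def price_paid_profile[OF T k] level_price_def)
  qed
  have u_self: "lottery_utility n x ?p (profile S) (profile S) =
      (if k \<le> card S then (real (card S) - real k) * (b - a) else 0)" if "S \<subseteq> {..<n}" for S
    using u[OF that that] by simp
  show "feasible_lottery n F x ?p"
    unfolding feasible_lottery_def
  proof (intro conjI ballI allI impI)
    fix v assume "v \<in> valuations n F"
    then obtain T where T: "T \<subseteq> {..<n}" "v = profile T" by (auto simp: valuations_eq)
    show "0 \<le> lottery_utility n x ?p v v" using u_self[OF T(1)] T(2) a_less_b by simp
    fix w assume "w \<in> valuations n F"
    then obtain S where S: "S \<subseteq> {..<n}" "w = profile S" by (auto simp: valuations_eq)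
    show "lottery_utility n x ?p w v \<le> lottery_utility n x ?p w w"
      using u_self[OF S(1)] u[OF S(1) T(1)] S(2) T(2) a_less_b
      by (auto simp: mult_le_0_iff intro: order_trans[of _ 0])
  qed (auto simp: x_def)
  show "(\<Sum>v\<in>valuations n F. ?p v * pmf (prior n F) v) =
      discounted_revenue n F (\<lambda>_. b) (bundle_price k)"
    unfolding discounted_revenue_def
    by (subst integral_measure_pmf_real[where A = "valuations n F"])
       (auto simp: valuations_eq valuations_def[symmetric])
qed

section \<open>Optimality of the computed threshold\<close>

definition worthwhile :: "nat \<Rightarrow> bool" where
  "worthwhile j \<longleftrightarrow> (b - a) * odds_tail odds n j \<le> a"

text \<open>Inherited from the monotonicity of \<open>odds_tail\<close>; it lets a single threshold
  separate the levels of nonnegative \<open>gain\<close> from those of nonpositive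
  \<open>gain\<close>.\<close>

lemma worthwhile_antimono:
  assumes "i \<le> j" "j \<le> n" "worthwhile j"
  shows "worthwhile i"
  using odds_tail_mono[OF less_imp_le[OF odds_pos] assms(1,2)] a_less_b assms(3)
  by (auto simp: worthwhile_def intro: order_trans[OF mult_left_mono])

theorem cutoff_optimal:
  "discounted_revenue n F (\<lambda>_. b) (bundle_price (cutoff worthwhile n n)) = Rev n F"
proof -
  let ?k = "cutoff worthwhile n n"
  have k: "?k \<le> n" by (rule cutoff_le)
  \<comment> \<open>For \<open>t < n\<close> the tested index \<open>n - t\<close> is at least 1,
    and by \<open>gain_eq\<close> this test decides the sign of \<open>gain t\<close>.\<close>
  have iff: "?k \<le> t \<longleftrightarrow> worthwhile (n - t)" if "t < n" for t
    using cutoff_le_iff[of n worthwhile "n - t" n] worthwhile_antimono that by simp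
  have sign: "0 \<le> gain t" if "?k \<le> t" "t < n" for t
    using iff[of t] that level_prob_pos[of t] by (auto simp: gain_eq worthwhile_def)
  have sign': "gain t \<le> 0" if "t < ?k" "t < n" for t
    using iff[of t] that level_prob_pos[of t]
    by (auto simp: gain_eq worthwhile_def intro!: mult_nonneg_nonpos)
  obtain x p where xp: "feasible_lottery n F x p" "(\<Sum>v\<in>valuations n F. p v * pmf (prior n F) v) =
      discounted_revenue n F (\<lambda>_. b) (bundle_price ?k)"
    using discounted_revenue_attained[OF k] .
  show ?thesis unfolding Rev_def
  proof (rule cSup_eq_maximum[symmetric])
    show "discounted_revenue n F (\<lambda>_. b) (bundle_price ?k) \<in>
        {\<Sum>v\<in>valuations n F. p v * pmf (prior n F) v | x p. feasible_lottery n F x p}"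
      using xp by force
  next
    fix y assume "y \<in> {\<Sum>v\<in>valuations n F. p v * pmf (prior n F) v | x p. feasible_lottery n F x p}"
    then show "y \<le> discounted_revenue n F (\<lambda>_. b) (bundle_price ?k)"
      using revenue_le[OF _ sign sign'] discounted_revenue_eq[OF k] by auto
  qed
qed

end

section \<open>Running time of random access programs\<close>

lemma len_pos: "1 \<le> len k"
  by (simp add: len_def)

lemma less_two_power_len: "k < 2 ^ len k"
proof -
  have "k < 2 ^ floorlog 2 k" by (rule floorlog_leD) simp_all
  also have "(2::nat) ^ floorlog 2 k \<le> 2 ^ len k" by (rule power_increasing) (auto simp: len_def)
  finally show ?thesis .
qed

lemma len_leI: "k < 2 ^ e \<Longrightarrow> 1 \<le> e \<Longrightarrow> len k \<le> e"
  by (simp add: len_def floorlog_leI)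

lemma len_mono: "j \<le> k \<Longrightarrow> len j \<le> len k"
  unfolding len_def by (intro max.mono floorlog_mono order_refl)

lemma len_mult_le: "len (j * k) \<le> len j + len k"
proof (rule len_leI)
  show "j * k < 2 ^ (len j + len k)"
    unfolding power_add using less_two_power_len by (intro mult_strict_mono') auto
qed (rule trans_le_add1[OF len_pos])

text \<open>Lengths are at least 1, so both powers of 2 are at least 2, and their sum is at most
  their product. The bound is coarse for long operands but has the form of the one for
  products.\<close>

lemma len_add_le: "len (j + k) \<le> len j + len k"
proof (rule len_leI)
  have ge2: "(2::nat) \<le> 2 ^ len i" for i
    using power_increasing[OF len_pos, of "2::nat" i] by simp
  have add_le_mult: "x + y \<le> x * y" if "2 \<le> x" "2 \<le> y" for x y :: nat
    using mult_le_mono1[OF that(1), of y] mult_le_mono2[OF that(2), of x] by linarith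
  have "j + k < 2 ^ len j + 2 ^ len k"
    using less_two_power_len by (rule add_strict_mono) (rule less_two_power_len)
  also have "\<dots> \<le> (2::nat) ^ len j * 2 ^ len k" by (intro add_le_mult ge2)
  finally show "j + k < 2 ^ (len j + len k)" by (simp add: power_add)
qed (rule trans_le_add1[OF len_pos])

lemma len_apply_arith_le: "len (apply_arith f j k) \<le> len j + len k"
proof (cases f)
  case Minus
  then show ?thesis using len_mono[of "j - k" j] by simp
next
  case Divide
  then show ?thesis using len_mono[of "j div k" j] by simp
qed (simp_all add: len_add_le len_mult_le)

section \<open>Cost of loop-free programs and of counted loops\<close>

fun exec :: "com \<Rightarrow> state \<Rightarrow> state" where
  "exec Skip s = s"
| "exec (Read l) (m, []) = (m(addr m l := 0), [])"
| "exec (Read l) (m, z # zs) = (m(addr m l := z), zs)"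
| "exec (Op l f y z) (m, zs) = (m(addr m l := apply_arith f (oval m y) (oval m z)), zs)"
| "exec (Seq c d) s = exec d (exec c s)"
| "exec (If_Pos y c d) (m, zs) = (if oval m y > 0 then exec c (m, zs) else exec d (m, zs))"
| "exec (While_Pos y c) s = s"

text \<open>On these programs \<open>exec\<close> agrees with \<open>run\<close>; its equation for
  loops is only a placeholder.\<close>

fun loop_free :: "com \<Rightarrow> bool" where
  "loop_free (Seq c d) \<longleftrightarrow> loop_free c \<and> loop_free d"
| "loop_free (If_Pos y c d) \<longleftrightarrow> loop_free c \<and> loop_free d"
| "loop_free (While_Pos y c) \<longleftrightarrow> False"
| "loop_free c \<longleftrightarrow> True"

text \<open>The unread input is included because reading moves it into memory.\<close>

definition width_le :: "nat \<Rightarrow> state \<Rightarrow> bool" where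
  "width_le B s \<longleftrightarrow> (\<forall>i. len (fst s i) \<le> B) \<and> (\<forall>z\<in>set (snd s). len z \<le> B)"

lemma width_le_mono: "width_le B s \<Longrightarrow> B \<le> B' \<Longrightarrow> width_le B' s"
  unfolding width_le_def by (meson order_trans)

lemma width_le_pos: "width_le B s \<Longrightarrow> 1 \<le> B"
  unfolding width_le_def by (meson len_pos order_trans)

lemma len_le_mult: "\<forall>i. len (m i) \<le> B \<Longrightarrow> len k \<le> len k * B"
  using order_trans[OF len_pos, of _ B] by (metis mult.right_neutral mult_le_mono2)

text \<open>\<open>C\<close> depends on the program text alone, not on the memory; constant address
  lengths are absorbed since \<open>B\<close> is at least 1.\<close>

lemma loc_cost_le: "\<exists>C. \<forall>m B. (\<forall>i. len (m i) \<le> B) \<longrightarrow> loc_cost m l \<le> C * B"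
proof (cases l)
  case (Cell i)
  show ?thesis unfolding Cell loc_cost.simps using len_le_mult by blast
next
  case (At i)
  have "loc_cost m l \<le> (len i + 1) * B" if "\<forall>i. len (m i) \<le> B" for m B
    using add_mono[OF len_le_mult[OF that, of i] that[rule_format, of i]] by (simp add: At)
  then show ?thesis by blast
qed

lemma ocost_le: "\<exists>C. \<forall>m B. (\<forall>i. len (m i) \<le> B) \<longrightarrow> ocost m y \<le> C * B"
proof (cases y)
  case (Const c)
  show ?thesis unfolding Const ocost.simps using len_le_mult by blast
next
  case (Val l)
  obtain C where C: "\<And>m B. (\<forall>i. len (m i) \<le> B) \<Longrightarrow> loc_cost m l \<le> C * B"
    using loc_cost_le by blast
  have "ocost m y \<le> (C + 1) * B" if "\<forall>i. len (m i) \<le> B" for m B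
    using C[OF that] that[rule_format, of "addr m l"] by (simp add: Val)
  then show ?thesis by blast
qed

lemma len_oval_le: "(\<forall>i. len (m i) \<le> B) \<Longrightarrow> len (oval m y) \<le> ocost m y"
  by (cases y) auto

text \<open>Every operation at most adds the bit lengths of its operands, so a program without loops
  enlarges the bit lengths of the cells by at most a constant factor.\<close>

lemma loop_free_run:
  "loop_free c \<Longrightarrow>
   \<exists>C. \<forall>s B. width_le B s \<longrightarrow> width_le (C * B) (exec c s) \<and> (\<exists>t\<le>C * B. run c s t (exec c s))"
proof (induction c)
  case Skip
  show ?case
    by (rule exI[of _ 1]) (auto intro: run.Skip width_le_pos)
next
  case (Read l)
  obtain C where C: "\<And>m B. (\<forall>i. len (m i) \<le> B) \<Longrightarrow> loc_cost m l \<le> C * B"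
    using loc_cost_le by blast
  have "width_le ((C + 1) * B) (exec (Read l) s) \<and> (\<exists>t\<le>(C + 1) * B. run (Read l) s t (exec (Read l) s))"
    if w: "width_le B s" for s B
  proof -
    obtain m zs where s: "s = (m, zs)" by (cases s)
    have cells: "\<forall>i. len (m i) \<le> B" using w by (simp add: width_le_def s)
    have len0: "len 0 \<le> B" using width_le_pos[OF w] by (simp add: len_def floorlog_def)
    have B_le: "B \<le> (C + 1) * B" by simp
    show ?thesis
    proof (cases zs)
      case Nil
      have "width_le B (exec (Read l) s)" using cells len0 by (simp add: width_le_def s Nil)
      moreover have "loc_cost m l + len 0 \<le> (C + 1) * B" using C[OF cells] len0 by simp
      ultimately show ?thesis
        using run.Read_End[of l m] width_le_mono[OF _ B_le] by (auto simp: s Nil)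
    next
      case (Cons z zs')
      have z: "len z \<le> B" using w by (simp add: width_le_def s Cons)
      have "width_le B (exec (Read l) s)" using w by (simp add: width_le_def s Cons)
      moreover have "loc_cost m l + len z \<le> (C + 1) * B" using C[OF cells] z by simp
      ultimately show ?thesis
        using run.Read[of l m z zs'] width_le_mono[OF _ B_le] by (auto simp: s Cons)
    qed
  qed
  then show ?case by blast
next
  case (Op l f y z)
  obtain C1 where C1: "\<And>m B. (\<forall>i. len (m i) \<le> B) \<Longrightarrow> loc_cost m l \<le> C1 * B"
    using loc_cost_le by blast
  obtain C2 where C2: "\<And>m B. (\<forall>i. len (m i) \<le> B) \<Longrightarrow> ocost m y \<le> C2 * B"
    using ocost_le by blast
  obtain C3 where C3: "\<And>m B. (\<forall>i. len (m i) \<le> B) \<Longrightarrow> ocost m z \<le> C3 * B"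
    using ocost_le by blast
  let ?C = "C1 + C2 + C3 + 1"
  have "width_le (?C * B) (exec (Op l f y z) s) \<and>
      (\<exists>t\<le>?C * B. run (Op l f y z) s t (exec (Op l f y z) s))"
    if w: "width_le B s" for s B
  proof -
    obtain m zs where s: "s = (m, zs)" by (cases s)
    have cells: "\<forall>i. len (m i) \<le> B" using w by (simp add: width_le_def s)
    have "loc_cost m l + ocost m y + ocost m z \<le> ?C * B"
      using C1[OF cells] C2[OF cells] C3[OF cells] by (simp add: algebra_simps)
    moreover have "len (apply_arith f (oval m y) (oval m z)) \<le> ?C * B"
    proof -
      have "len (apply_arith f (oval m y) (oval m z)) \<le> ocost m y + ocost m z"
        using len_apply_arith_le add_mono[OF len_oval_le[OF cells] len_oval_le[OF cells]]
        by (rule order_trans)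
      then show ?thesis using C2[OF cells] C3[OF cells] by (simp add: algebra_simps)
    qed
    moreover have "width_le (?C * B) s" using w by (rule width_le_mono) simp
    ultimately show ?thesis
      using run.Op[of l f y z m zs] by (auto simp: width_le_def s)
  qed
  then show ?case by blast
next
  case (Seq c d)
  obtain C where C: "\<And>s B. width_le B s \<Longrightarrow>
      width_le (C * B) (exec c s) \<and> (\<exists>t\<le>C * B. run c s t (exec c s))"
    using Seq by auto
  obtain D where D: "\<And>s B. width_le B s \<Longrightarrow>
      width_le (D * B) (exec d s) \<and> (\<exists>t\<le>D * B. run d s t (exec d s))"
    using Seq by auto
  \<comment> \<open>\<open>d\<close> starts from widths up to \<open>C * B\<close>, hence the
    product \<open>D * C\<close>.\<close>
  have "width_le ((C + D * C) * B) (exec (Seq c d) s) \<and>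
      (\<exists>t\<le>(C + D * C) * B. run (Seq c d) s t (exec (Seq c d) s))"
    if w: "width_le B s" for s B
  proof -
    obtain t where t: "t \<le> C * B" "run c s t (exec c s)" and wc: "width_le (C * B) (exec c s)"
      using C[OF w] by blast
    obtain u where u: "u \<le> D * (C * B)" "run d (exec c s) u (exec d (exec c s))"
      and wd: "width_le (D * (C * B)) (exec d (exec c s))"
      using D[OF wc] by blast
    have "t + u \<le> (C + D * C) * B" using t(1) u(1) by (simp add: algebra_simps)
    then show ?thesis
      using run.Seq[OF t(2) u(2)] width_le_mono[OF wd] by (auto simp: algebra_simps)
  qed
  then show ?case by blast
next
  case (If_Pos y c d)
  obtain C where C: "\<And>s B. width_le B s \<Longrightarrow>
      width_le (C * B) (exec c s) \<and> (\<exists>t\<le>C * B. run c s t (exec c s))"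
    using If_Pos by auto
  obtain D where D: "\<And>s B. width_le B s \<Longrightarrow>
      width_le (D * B) (exec d s) \<and> (\<exists>t\<le>D * B. run d s t (exec d s))"
    using If_Pos by auto
  obtain E where E: "\<And>m B. (\<forall>i. len (m i) \<le> B) \<Longrightarrow> ocost m y \<le> E * B"
    using ocost_le by blast
  let ?C = "E + C + D"
  have "width_le (?C * B) (exec (If_Pos y c d) s) \<and>
      (\<exists>t\<le>?C * B. run (If_Pos y c d) s t (exec (If_Pos y c d) s))"
    if w: "width_le B s" for s B
  proof -
    obtain m zs where s: "s = (m, zs)" by (cases s)
    have guard: "ocost m y \<le> E * B" using w by (intro E) (simp add: width_le_def s)
    show ?thesis
    proof (cases "oval m y > 0")
      case True
      obtain t where t: "t \<le> C * B" "run c s t (exec c s)" and wc: "width_le (C * B) (exec c s)"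
        using C[OF w] by blast
      have "ocost m y + t \<le> ?C * B" using guard t(1) by (simp add: algebra_simps)
      then show ?thesis
        using run.If_True[OF True t(2)[unfolded s], of d] width_le_mono[OF wc, of "?C * B"] True
        by (auto simp: s)
    next
      case False
      obtain t where t: "t \<le> D * B" "run d s t (exec d s)" and wd: "width_le (D * B) (exec d s)"
        using D[OF w] by blast
      have "ocost m y + t \<le> ?C * B" using guard t(1) by (simp add: algebra_simps)
      then show ?thesis
        using run.If_False[OF _ t(2)[unfolded s], of y c] width_le_mono[OF wd, of "?C * B"] False
        by (auto simp: s)
    qed
  qed
  then show ?case by blast
qed simp

text \<open>The index of \<open>I\<close> is the exact number of iterations left. The guard is
  evaluated once more than the body, hence the final \<open>G\<close>.\<close>

lemma while_run:
  assumes step: "\<And>r m zs. I (Suc r) (m, zs) \<Longrightarrow> oval m y > 0 \<and> ocost m y \<le> G \<and>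
      (\<exists>t s'. run c (m, zs) t s' \<and> t \<le> T \<and> I r s')"
    and exit: "\<And>m zs. I 0 (m, zs) \<Longrightarrow> oval m y = 0 \<and> ocost m y \<le> G"
    and init: "I r s"
  shows "\<exists>t s'. run (While_Pos y c) s t s' \<and> t \<le> r * (G + T) + G \<and> I 0 s'"
  using init
proof (induction r arbitrary: s)
  case 0
  obtain m zs where s: "s = (m, zs)" by (cases s)
  show ?case using exit[of m zs] run.While_False[of m y c zs] 0 by (auto simp: s)
next
  case (Suc r)
  obtain m zs where s: "s = (m, zs)" by (cases s)
  obtain t s' where step': "oval m y > 0" "ocost m y \<le> G" "run c (m, zs) t s'" "t \<le> T" "I r s'"
    using step[of r m zs] Suc.prems s by blast
  obtain u s'' where rest: "run (While_Pos y c) s' u s''" "u \<le> r * (G + T) + G" "I 0 s''"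
    using Suc.IH[OF step'(5)] by blast
  have "run (While_Pos y c) s (ocost m y + t + u) s''"
    unfolding s using step' rest by (intro run.While_True)
  moreover have "ocost m y + t + u \<le> Suc r * (G + T) + G" using step' rest by simp
  ultimately show ?case using rest(3) by blast
qed

section \<open>Computing the cutoff\<close>

text \<open>\<open>tail_frac\<close> is \<open>odds_tail\<close> as an unreduced fraction, for odds \<open>h / l\<close>.\<close>

primrec tail_frac :: "nat \<Rightarrow> nat \<Rightarrow> nat \<Rightarrow> nat \<Rightarrow> nat \<times> nat" where
  "tail_frac h l n 0 = (0, 1)"
| "tail_frac h l n (Suc j) =
     (h * (j * fst (tail_frac h l n j) + snd (tail_frac h l n j)),
      (n - j) * (l * snd (tail_frac h l n j)))"

lemma tail_frac_pos: "0 < l \<Longrightarrow> j \<le> n \<Longrightarrow> 0 < snd (tail_frac h l n j)"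
  by (induction j) auto

lemma odds_tail_eq_frac:
  assumes "0 < l" "j \<le> n"
  shows "odds_tail (real h / real l) n j =
    real (fst (tail_frac h l n j)) / real (snd (tail_frac h l n j))"
  using assms(2)
proof (induction j)
  case (Suc j)
  have "0 < real (snd (tail_frac h l n j))" using tail_frac_pos assms(1) Suc.prems by simp
  then show ?case using Suc assms(1) by (simp add: field_simps)
qed simp

text \<open>One level multiplies the bound by at most \<open>G\<close>, so even without reducing
  fractions the bit lengths grow only linearly in the number of levels.\<close>

lemma tail_frac_le:
  assumes "h * (n + 1) \<le> G" "n * l \<le> G" "j \<le> n"
  shows "fst (tail_frac h l n j) \<le> G ^ j \<and> snd (tail_frac h l n j) \<le> G ^ j"
  using assms(3)
proof (induction j)
  case (Suc j)
  let ?N = "fst (tail_frac h l n j)" and ?D = "snd (tail_frac h l n j)"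
  have IH: "?N \<le> G ^ j" "?D \<le> G ^ j" using Suc by auto
  have "h * (j * ?N + ?D) \<le> h * (n * G ^ j + G ^ j)"
    using IH Suc.prems by (intro mult_le_mono2 add_mono mult_le_mono) auto
  also have "\<dots> = h * (n + 1) * G ^ j" by (simp add: algebra_simps)
  also have "\<dots> \<le> G * G ^ j" using assms(1) by (rule mult_le_mono1)
  finally have "h * (j * ?N + ?D) \<le> G ^ Suc j" by simp
  moreover have "(n - j) * (l * ?D) \<le> n * (l * G ^ j)" using IH by (intro mult_le_mono) auto
  then have "(n - j) * (l * ?D) \<le> n * l * G ^ j" by (simp add: mult.assoc)
  then have "(n - j) * (l * ?D) \<le> G * G ^ j"
    by (rule order_trans) (rule mult_le_mono1[OF assms(2)])
  ultimately show ?case by simp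
qed simp

definition frac_test :: "nat \<Rightarrow> nat \<Rightarrow> nat \<Rightarrow> nat \<Rightarrow> nat \<Rightarrow> nat \<Rightarrow> bool" where
  "frac_test \<alpha> \<delta> h l n j \<longleftrightarrow> \<delta> * fst (tail_frac h l n j) \<le> \<alpha> * snd (tail_frac h l n j)"

section \<open>The program and its effect on memory\<close>

abbreviation cell :: "nat \<Rightarrow> operand" where
  "cell i \<equiv> Val (Cell i)"

abbreviation copy :: "nat \<Rightarrow> nat \<Rightarrow> com" where
  "copy i j \<equiv> Op (Cell i) Plus (cell j) (Const 0)"

primrec block :: "com list \<Rightarrow> com" where
  "block [] = Skip"
| "block (c # cs) = Seq c (block cs)"

text \<open>Cell 0 holds the candidate cutoff, cell 1 counts down the remaining levels, cell 2 counts
  up the visited ones, cells 3 and 4 hold the fraction, and cells 5, 6, 7, 8 hold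
  \<open>\<alpha>\<close>, \<open>\<delta>\<close>, \<open>h\<close>, \<open>l\<close>, where \<open>\<alpha>\<close> and \<open>\<delta>\<close> are \<open>a\<close> and \<open>b - a\<close> cleared of denominators by a common
  factor. Since the items are identically distributed, only the first listing is read; its numerators and
  denominators go into cells 11 to 18.\<close>

definition load_input :: com where
  "load_input = block (map (\<lambda>i. Read (Cell i)) [1, 9, 11, 12, 13, 14, 15, 16, 17, 18])"

text \<open>The listing order is arbitrary. The products are formed as if the lower value came
  first; a truncated difference of 0 in cell 9 reveals the opposite, and the roles are then
  exchanged. The fraction starts as 0/1.\<close>

definition order_values :: com where
  "order_values = block
    [copy 0 1,
     Op (Cell 4) Plus (Const 1) (Const 0),
     Op (Cell 5) Times (cell 11) (cell 16),
     Op (Cell 6) Times (cell 15) (cell 12),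
     Op (Cell 7) Times (cell 17) (cell 14),
     Op (Cell 8) Times (cell 13) (cell 18),
     Op (Cell 9) Minus (cell 6) (cell 5),
     If_Pos (cell 9) (copy 6 9)
      (block [Op (Cell 9) Minus (cell 5) (cell 6), copy 5 6, copy 6 9,
              copy 9 7, copy 7 8, copy 8 9])]"

definition level_step :: com where
  "level_step = block
    [Op (Cell 9) Times (cell 2) (cell 3),
     Op (Cell 9) Plus (cell 9) (cell 4),
     Op (Cell 3) Times (cell 7) (cell 9),
     Op (Cell 4) Times (cell 8) (cell 4),
     Op (Cell 4) Times (cell 1) (cell 4),
     Op (Cell 2) Plus (cell 2) (Const 1),
     Op (Cell 1) Minus (cell 1) (Const 1),
     Op (Cell 9) Times (cell 6) (cell 3),
     Op (Cell 10) Times (cell 5) (cell 4),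
     Op (Cell 9) Minus (cell 9) (cell 10),
     If_Pos (cell 9) Skip (copy 0 1)]"

definition setup_cells :: com where
  "setup_cells = Seq load_input order_values"

definition cutoff_program :: com where
  "cutoff_program = Seq setup_cells (While_Pos (cell 1) level_step)"

text \<open>Cells 1 and 2 enter the fraction before they are updated, and the truncated difference
  in cell 9 is 0 exactly when the test succeeds.\<close>

lemma exec_level_step:
  fixes m :: memory
  defines "N \<equiv> m 7 * (m 2 * m 3 + m 4)" and "D \<equiv> m 1 * (m 8 * m 4)"
  shows "exec level_step (m, zs) =
    (m(9 := m 6 * N - m 5 * D, 10 := m 5 * D, 3 := N, 4 := D, 2 := m 2 + 1, 1 := m 1 - 1,
       0 := (if m 6 * N \<le> m 5 * D then m 1 - 1 else m 0)), zs)"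
  unfolding N_def D_def by (auto simp: level_step_def fun_eq_iff)

lemma exec_setup_cells:
  assumes "exec setup_cells (\<lambda>_. 0, n # e # x1 # y1 # u1 # w1 # x2 # y2 # u2 # w2 # zs) = (m, zs')"
  shows "m 0 = n" "m 1 = n" "m 2 = 0" "m 3 = 0" "m 4 = 1" "zs' = zs"
    "m 5 = (if x1 * y2 < x2 * y1 then x1 * y2 else x2 * y1)"
    "m 6 = (if x1 * y2 < x2 * y1 then x2 * y1 - x1 * y2 else x1 * y2 - x2 * y1)"
    "m 7 = (if x1 * y2 < x2 * y1 then u2 * w1 else u1 * w2)"
    "m 8 = (if x1 * y2 < x2 * y1 then u1 * w2 else u2 * w1)"
  using assms by (auto simp: setup_cells_def load_input_def order_values_def split: if_splits)

definition loop_inv ::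
    "nat \<Rightarrow> nat \<Rightarrow> nat \<Rightarrow> nat \<Rightarrow> nat \<Rightarrow> nat \<Rightarrow> nat list \<Rightarrow> nat \<Rightarrow> state \<Rightarrow> bool" where
  "loop_inv L \<alpha> \<delta> h l n zs r s \<longleftrightarrow> r \<le> n \<and> width_le L s \<and> snd s = zs \<and>
     fst s 0 = cutoff (frac_test \<alpha> \<delta> h l n) n (n - r) \<and> fst s 1 = r \<and> fst s 2 = n - r \<and>
     fst s 3 = fst (tail_frac h l n (n - r)) \<and> fst s 4 = snd (tail_frac h l n (n - r)) \<and>
     fst s 5 = \<alpha> \<and> fst s 6 = \<delta> \<and> fst s 7 = h \<and> fst s 8 = l"

text \<open>Iterating the width bound of \<open>loop_free_run\<close> would multiply it by a
  constant in every round. Instead the contents after a round are known exactly, and one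
  \<open>L\<close> that bounds their closed forms serves all rounds.\<close>

lemma loop_inv_step:
  assumes inv: "loop_inv L \<alpha> \<delta> h l n zs (Suc r) (m, zs')"
    and L: "\<And>j. j \<le> n \<Longrightarrow> len (fst (tail_frac h l n j)) \<le> L"
      "\<And>j. j \<le> n \<Longrightarrow> len (snd (tail_frac h l n j)) \<le> L"
      "\<And>j. j \<le> n \<Longrightarrow> len (\<delta> * fst (tail_frac h l n j)) \<le> L"
      "\<And>j. j \<le> n \<Longrightarrow> len (\<alpha> * snd (tail_frac h l n j)) \<le> L"
      "len n \<le> L"
  shows "loop_inv L \<alpha> \<delta> h l n zs r (exec level_step (m, zs'))"
proof -
  define j where "j = n - Suc r"
  have j: "n - Suc r = j" "n - r = Suc j" "Suc r = n - j" "Suc j \<le> n" "r = n - Suc j"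
    using inv by (auto simp: j_def loop_inv_def)
  have m: "m 0 = cutoff (frac_test \<alpha> \<delta> h l n) n j" "m 1 = n - j" "m 2 = j"
    "m 3 = fst (tail_frac h l n j)" "m 4 = snd (tail_frac h l n j)"
    "m 5 = \<alpha>" "m 6 = \<delta>" "m 7 = h" "m 8 = l" "zs' = zs" and w: "width_le L (m, zs)"
    using inv j(3) unfolding loop_inv_def j(1) by auto
  have N: "m 7 * (m 2 * m 3 + m 4) = fst (tail_frac h l n (Suc j))"
    and D: "m 1 * (m 8 * m 4) = snd (tail_frac h l n (Suc j))"
    using m by simp_all
  define m' where "m' = m
    (9 := \<delta> * fst (tail_frac h l n (Suc j)) - \<alpha> * snd (tail_frac h l n (Suc j)),
     10 := \<alpha> * snd (tail_frac h l n (Suc j)), 3 := fst (tail_frac h l n (Suc j)),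
     4 := snd (tail_frac h l n (Suc j)), 2 := Suc j, 1 := n - Suc j,
     0 := cutoff (frac_test \<alpha> \<delta> h l n) n (Suc j))"
  have exec: "exec level_step (m, zs') = (m', zs)"
    unfolding exec_level_step N D m'_def using m(1-3,6,7,10)
    by (simp add: frac_test_def del: tail_frac.simps)
  have "len (m' i) \<le> L" for i
  proof -
    have "len (\<delta> * fst (tail_frac h l n (Suc j)) - \<alpha> * snd (tail_frac h l n (Suc j))) \<le> L"
      using len_mono[OF diff_le_self] L(3)[OF j(4)] by (rule order_trans)
    moreover have "len i \<le> L" if "i \<le> n" for i
      using len_mono[OF that] L(5) by (rule order_trans)
    moreover have "cutoff (frac_test \<alpha> \<delta> h l n) n (Suc j) \<le> n" by (rule cutoff_le)
    moreover have "len (m i) \<le> L" using w by (simp add: width_le_def)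
    ultimately show ?thesis
      unfolding m'_def using L(1-4)[OF j(4)] j(4)
      by (simp del: tail_frac.simps cutoff.simps)
  qed
  then have "width_le L (m', zs)" using w by (simp add: width_le_def)
  then show ?thesis unfolding exec loop_inv_def j
    using j(4) m by (simp add: m'_def del: tail_frac.simps cutoff.simps)
qed

lemma cutoff_cong:
  "(\<And>i. 1 \<le> i \<Longrightarrow> i \<le> j \<Longrightarrow> T i \<longleftrightarrow> T' i) \<Longrightarrow> cutoff T n j = cutoff T' n j"
  by (induction j) auto

text \<open>This is \<open>tail_frac_le\<close> with \<open>G = 2 ^ W * 2 ^ W\<close>, as
  \<open>h\<close>, \<open>l\<close> and \<open>n + 1\<close> are at most \<open>2 ^ W\<close>. The
  final 1 provides the strict inequality that \<open>len_leI\<close> asks for.\<close>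

lemma tail_frac_len_le:
  assumes "len h \<le> W" "len l \<le> W" "n < 2 ^ W" "j \<le> n"
  shows "len (fst (tail_frac h l n j)) \<le> 2 * W * n + 1"
    and "len (snd (tail_frac h l n j)) \<le> 2 * W * n + 1"
proof -
  have pow: "i \<le> 2 ^ W" if "len i \<le> W" for i
    using less_two_power_len[of i] power_increasing[OF that, of "2::nat"] by linarith
  have "h * (n + 1) \<le> 2 ^ W * 2 ^ W" "n * l \<le> 2 ^ W * 2 ^ W"
    using assms pow by (intro mult_le_mono; simp)+
  then have "fst (tail_frac h l n j) \<le> (2 ^ W * 2 ^ W) ^ j \<and> snd (tail_frac h l n j) \<le> (2 ^ W * 2 ^ W) ^ j"
    using assms(4) by (rule tail_frac_le)
  moreover have "(2 ^ W * 2 ^ W) ^ j < (2::nat) ^ (2 * W * n + 1)"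
  proof -
    have "(2 ^ W * 2 ^ W) ^ j = (2::nat) ^ (2 * W * j)"
      by (simp add: power_add[symmetric] power_mult[symmetric] mult_2)
    also have "\<dots> < 2 ^ (2 * W * n + 1)"
      using mult_le_mono2[OF assms(4), of "2 * W"]
      by (intro power_strict_increasing) (linarith, simp)
    finally show ?thesis .
  qed
  ultimately show "len (fst (tail_frac h l n j)) \<le> 2 * W * n + 1"
    "len (snd (tail_frac h l n j)) \<le> 2 * W * n + 1"
    by (auto intro!: len_leI elim: order.strict_trans1)
qed

section \<open>Decoding the presented instance\<close>

lemma encode_rat_nonneg:
  assumes "0 \<le> r"
  obtains x y where "encode_rat r = [x, y]" "0 < y" "(of_rat r :: real) = real x / real y"
proof -
  obtain x y where xy: "quotient_of r = (x, y)" by (cases "quotient_of r")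
  have y: "0 < y" using quotient_of_denom_pos[OF xy] .
  have r: "r = of_int x / of_int y" using quotient_of_div[OF xy] .
  then have "0 \<le> x" using assms y by (simp add: zero_le_divide_iff)
  then have "(of_rat r :: real) = real (nat x) / real (nat y)"
    using y by (simp add: r of_rat_divide)
  then show ?thesis using that[of "nat x" "nat y"] y by (simp add: encode_rat_def xy)
qed

text \<open>Distinct first components and the injectivity of \<open>of_rat\<close> make the length
  of the list equal to the support size 2.\<close>

lemma listing_two_points:
  assumes "listing xs G" "set_pmf G = {a, b}" "a \<noteq> b"
  obtains v p w q where "xs = [(v, p), (w, q)]" "{of_rat v, of_rat w} = {a, b}"
    "pmf G (of_rat v) = of_rat p" "pmf G (of_rat w) = of_rat q"
proof -
  have "length xs = card (fst ` set xs)"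
    using assms(1) distinct_card[of "map fst xs"] by (simp add: listing_def)
  also have "\<dots> = card ((of_rat :: rat \<Rightarrow> real) ` fst ` set xs)"
    by (rule card_image[symmetric]) (simp add: inj_on_def)
  also have "\<dots> = 2" using assms by (simp add: listing_def)
  finally obtain s t where st: "xs = [s, t]"
    by (auto simp: numeral_2_eq_2 length_Suc_conv)
  obtain v p w q where vw: "s = (v, p)" "t = (w, q)" by (cases s, cases t)
  show ?thesis
    by (rule that[of v p w q]) (use assms(1,2) in \<open>auto simp: listing_def st vw\<close>)
qed

text \<open>Every listing has size at least 1. Hence the \<open>n\<close> rounds of the loop are
  linear in the input size, although the number \<open>n\<close> itself is charged only its bit
  length.\<close>

lemma length_le_input_size: "length xss \<le> input_size (encode_instance xss)"
proof -
  have "length xss \<le> sum_list (map len (concat (map encode_listing xss)))"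
  proof (induction xss)
    case (Cons xs xss)
    have "1 \<le> sum_list (map len (encode_listing xs))"
      by (simp add: encode_listing_def trans_le_add1[OF len_pos, unfolded One_nat_def])
    then show ?case using Cons by simp
  qed simp
  then show ?thesis by (simp add: input_size_def encode_instance_def)
qed

lemma initial_width:
  assumes "inp \<noteq> []"
  shows "width_le (input_size inp) (\<lambda>_. 0, inp)"
proof -
  have mem: "len z \<le> input_size inp" if "z \<in> set inp" for z
    using member_le_sum_list[of "len z" "map len inp"] that by (simp add: input_size_def)
  obtain z where "z \<in> set inp" using assms by (cases inp) auto
  then have "1 \<le> input_size inp" using mem len_pos order_trans by blast
  then show ?thesis using mem by (simp add: width_le_def len_def floorlog_def)
qed

section \<open>Correctness and running time of the program\<close>

context two_point_iid
begin

lemma setup_cells_correct: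
  assumes xs: "listing xs (F 0)"
    and exec: "exec setup_cells (\<lambda>_. 0, n # encode_listing xs @ zs) = (m, zs')"
  shows "m 0 = n \<and> m 1 = n \<and> m 2 = 0 \<and> m 3 = 0 \<and> m 4 = 1 \<and>
    0 < m 8 \<and> real (m 7) / real (m 8) = odds \<and>
    (\<exists>c>0. real (m 5) = c * a \<and> real (m 6) = c * (b - a))"
proof -
  have set: "set_pmf (F 0) = {a, b}" using set_pmf_F n_pos by simp
  obtain v1 p1 v2 p2 where xs_eq: "xs = [(v1, p1), (v2, p2)]"
    and ab: "{of_rat v1, of_rat v2} = {a, b}"
    and p: "pmf (F 0) (of_rat v1) = of_rat p1" "pmf (F 0) (of_rat v2) = of_rat p2"
    using listing_two_points[OF xs set] a_less_b by blast
  have "\<forall>x\<in>{a, b}. 0 \<le> x" using a_nonneg a_less_b by simp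
  then have "0 \<le> (of_rat v1 :: real)" "0 \<le> (of_rat v2 :: real)"
    unfolding ab[symmetric] by blast+
  then have v_nonneg: "0 \<le> v1" "0 \<le> v2" by simp_all
  have "0 < pmf (F 0) (of_rat v1)" "0 < pmf (F 0) (of_rat v2)"
    using ab set by (auto intro!: pmf_positive)
  then have p_pos: "0 < p1" "0 < p2" unfolding p by simp_all
  obtain x1 y1 where v1: "encode_rat v1 = [x1, y1]" "0 < y1" "of_rat v1 = real x1 / real y1"
    using encode_rat_nonneg v_nonneg(1) .
  obtain x2 y2 where v2: "encode_rat v2 = [x2, y2]" "0 < y2" "of_rat v2 = real x2 / real y2"
    using encode_rat_nonneg v_nonneg(2) .
  obtain u1 w1 where p1: "encode_rat p1 = [u1, w1]" "0 < w1" "of_rat p1 = real u1 / real w1"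
    using encode_rat_nonneg less_imp_le[OF p_pos(1)] .
  obtain u2 w2 where p2: "encode_rat p2 = [u2, w2]" "0 < w2" "of_rat p2 = real u2 / real w2"
    using encode_rat_nonneg less_imp_le[OF p_pos(2)] .
  have "0 < (of_rat p1 :: real)" "0 < (of_rat p2 :: real)" using p_pos by simp_all
  then have u_pos: "0 < u1" "0 < u2" unfolding p1 p2 using p1 p2 by (auto simp: zero_less_divide_iff)
  have "exec setup_cells (\<lambda>_. 0, n # 2 # x1 # y1 # u1 # w1 # x2 # y2 # u2 # w2 # zs) = (m, zs')"
    using exec by (simp add: encode_listing_def xs_eq v1 v2 p1 p2 numeral_2_eq_2)
  note m = exec_setup_cells[OF this]
  have less_iff: "x1 * y2 < x2 * y1 \<longleftrightarrow> (of_rat v1 :: real) < of_rat v2"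
    unfolding v1 v2 using v1(2) v2(2)
    by (simp add: divide_less_eq less_divide_eq mult.commute flip: of_nat_mult)
  consider "of_rat v1 = a" "of_rat v2 = b" | "of_rat v1 = b" "of_rat v2 = a"
    using ab a_less_b by (auto simp: doubleton_eq_iff)
  then show ?thesis
  proof cases
    case 1
    have less: "x1 * y2 < x2 * y1" using less_iff 1 a_less_b by simp
    have "real (m 7) / real (m 8) = odds"
      using p 1 u_pos p1(2) p2(2) unfolding odds_def high_prob_def low_prob_def
      by (simp add: m less p1(3) p2(3))
    \<comment> \<open>The common factor is the product of the denominators of the two
      values.\<close>
    moreover have "real (m 5) = real (y1 * y2) * a" "real (m 6) = real (y1 * y2) * (b - a)"
      unfolding 1[symmetric] v1 v2 using v1(2) v2(2) less
      by (simp_all add: m of_nat_diff right_diff_distrib)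
    ultimately show ?thesis using m(1-5) less u_pos p1(2) p2(2) v1(2) v2(2)
      by (auto simp: m(10) intro!: exI[of _ "real (y1 * y2)"])
  next
    case 2
    have less: "\<not> x1 * y2 < x2 * y1" using less_iff 2 a_less_b by simp
    have "real (m 7) / real (m 8) = odds"
      using p 2 u_pos p1(2) p2(2) unfolding odds_def high_prob_def low_prob_def
      by (simp add: m less p1(3) p2(3))
    moreover have "real (m 5) = real (y1 * y2) * a" "real (m 6) = real (y1 * y2) * (b - a)"
      unfolding 2[symmetric] v1 v2 using v1(2) v2(2) less
      by (simp_all add: m of_nat_diff right_diff_distrib)
    ultimately show ?thesis using m(1-5) less u_pos p1(2) p2(2) v1(2) v2(2)
      by (auto simp: m(10) intro!: exI[of _ "real (y1 * y2)"])
  qed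
qed

lemma frac_test_iff_worthwhile:
  assumes "0 < l" "real h / real l = odds" "0 < c" "real \<alpha> = c * a" "real \<delta> = c * (b - a)" "j \<le> n"
  shows "frac_test \<alpha> \<delta> h l n j \<longleftrightarrow> worthwhile j"
proof -
  define N D where "N = fst (tail_frac h l n j)" and "D = snd (tail_frac h l n j)"
  have D: "0 < D" unfolding D_def using assms(1,6) by (rule tail_frac_pos)
  have odds: "odds_tail odds n j = real N / real D"
    using odds_tail_eq_frac[OF assms(1,6), of h] by (simp add: assms(2) N_def D_def)
  have "frac_test \<alpha> \<delta> h l n j \<longleftrightarrow> real (\<delta> * N) \<le> real (\<alpha> * D)"
    by (simp only: frac_test_def N_def D_def of_nat_le_iff)
  also have "\<dots> \<longleftrightarrow> c * ((b - a) * real N) \<le> c * (a * real D)"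
    by (simp add: assms(4,5) mult.assoc)
  also have "\<dots> \<longleftrightarrow> (b - a) * real N \<le> a * real D" using assms(3) by simp
  also have "\<dots> \<longleftrightarrow> worthwhile j"
    using D by (simp add: worthwhile_def odds divide_le_eq)
  finally show ?thesis .
qed

end

text \<open>In the input size, \<open>W\<close> bounds the widths after the setup and
  \<open>L\<close> those in the loop. The summands pay for the setup, for at most as many rounds of
  body and guard as the input size, and for the last guard.\<close>

definition time_bound :: "nat \<Rightarrow> nat \<Rightarrow> nat poly" where
  "time_bound C D =
     (let W = [:0, C + 1:]; L = [:2:] * W * [:0, 1:] + W + 1
      in [:0, C:] + [:0, 1:] * ([:D + 2:] * L) + [:2:] * L)"

lemma cutoff_program_correct:
  assumes C: "\<And>s B. width_le B s \<Longrightarrow> width_le (C * B) (exec setup_cells s) \<and>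
      (\<exists>t\<le>C * B. run setup_cells s t (exec setup_cells s))"
    and D: "\<And>s B. width_le B s \<Longrightarrow> (\<exists>t\<le>D * B. run level_step s t (exec level_step s))"
    and iid: "two_point_iid a b n F"
    and xss: "length xss = n" "\<And>i. i < n \<Longrightarrow> listing (xss ! i) (F i)"
  shows "computes_within cutoff_program (encode_instance xss)
    (poly (time_bound C D) (input_size (encode_instance xss)))
    (cutoff (two_point_iid.worthwhile a b n F) n n)"
proof -
  interpret two_point_iid a b n F by (rule iid)
  define inp where "inp = encode_instance xss"
  define S where "S = input_size inp"
  define W where "W = (C + 1) * S"
  \<comment> \<open>The fractions fit into \<open>2 * W * S + 1\<close> bits; the further
    \<open>W\<close> allows for the products with \<open>m 5\<close> and \<open>m 6\<close>.\<close>
  define L where "L = 2 * W * S + W + 1"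
  obtain xs yss where xs: "xss = xs # yss" using xss(1) n_pos by (cases xss) auto
  have "listing xs (F 0)" using xss(2)[of 0] n_pos by (simp add: xs)
  moreover have inp: "inp = n # encode_listing xs @ concat (map encode_listing yss)"
    using xss(1) by (simp add: inp_def encode_instance_def xs)
  moreover obtain m zs where exec: "exec setup_cells (\<lambda>_. 0, inp) = (m, zs)"
    by (cases "exec setup_cells (\<lambda>_. 0, inp)")
  ultimately have m: "m 0 = n" "m 1 = n" "m 2 = 0" "m 3 = 0" "m 4 = 1" "0 < m 8"
      "real (m 7) / real (m 8) = odds"
    and scale: "\<exists>c>0. real (m 5) = c * a \<and> real (m 6) = c * (b - a)"
    using setup_cells_correct by blast+
  have n_S: "n \<le> S" using length_le_input_size[of xss] by (simp add: S_def inp_def xss(1))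
  have S_W: "S \<le> W" by (simp add: W_def)
  have W_L: "W \<le> L" by (simp add: L_def)
  have "width_le S (\<lambda>_. 0, inp)" unfolding S_def by (rule initial_width) (simp add: inp)
  note init = C[OF this, unfolded exec]
  have width_W: "width_le W (m, zs)"
    using init by (auto simp: W_def intro: width_le_mono)
  have len_W: "len (m i) \<le> W" for i using width_W by (simp add: width_le_def)
  have n_less: "n < 2 ^ W" using n_S S_W by (meson le_less_trans less_exp order_trans)
  have frac_L: "len (fst (tail_frac (m 7) (m 8) n j)) + W \<le> L"
    "len (snd (tail_frac (m 7) (m 8) n j)) + W \<le> L" if "j \<le> n" for j
    using tail_frac_len_le[OF len_W len_W n_less that, of 7 8]
      mult_le_mono2[OF n_S, of "2 * W"] unfolding L_def by linarith+
  let ?I = "loop_inv L (m 5) (m 6) (m 7) (m 8) n zs"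
  let ?k = "cutoff worthwhile n n"
  have "\<exists>t s'. run (While_Pos (cell 1) level_step) (m, zs) t s' \<and>
      t \<le> n * (2 * L + D * L) + 2 * L \<and> ?I 0 s'"
  proof (rule while_run[where I = ?I])
    have guard: "ocost m' (cell 1) \<le> 2 * L" if "?I r (m', zs')" for r m' zs'
    proof -
      have "len (m' 1) \<le> L" using that unfolding loop_inv_def width_le_def fst_conv by blast
      moreover have "len 1 \<le> L" by (simp add: len_def floorlog_def L_def)
      ultimately show ?thesis by simp
    qed
    show "0 < oval m' (cell 1) \<and> ocost m' (cell 1) \<le> 2 * L \<and>
        (\<exists>t s'. run level_step (m', zs') t s' \<and> t \<le> D * L \<and> ?I r s')"
      if inv: "?I (Suc r) (m', zs')" for r m' zs'
    proof -
      have "?I r (exec level_step (m', zs'))"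
        using inv
      proof (rule loop_inv_step)
        fix j assume j: "j \<le> n"
        show "len (fst (tail_frac (m 7) (m 8) n j)) \<le> L"
          "len (snd (tail_frac (m 7) (m 8) n j)) \<le> L" using frac_L[OF j] by simp_all
        show "len (m 6 * fst (tail_frac (m 7) (m 8) n j)) \<le> L"
          using len_mult_le[of "m 6" "fst (tail_frac (m 7) (m 8) n j)"] frac_L(1)[OF j] len_W[of 6]
          by linarith
        show "len (m 5 * snd (tail_frac (m 7) (m 8) n j)) \<le> L"
          using len_mult_le[of "m 5" "snd (tail_frac (m 7) (m 8) n j)"] frac_L(2)[OF j] len_W[of 5]
          by linarith
      next
        show "len n \<le> L" using len_W[of 0] W_L m(1) by simp
      qed
      moreover have "width_le L (m', zs')" using inv unfolding loop_inv_def by blast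
      moreover have "0 < oval m' (cell 1)" using inv by (simp add: loop_inv_def)
      ultimately show ?thesis using D[of L "(m', zs')"] guard[OF inv] by blast
    qed
    show "oval m' (cell 1) = 0 \<and> ocost m' (cell 1) \<le> 2 * L" if "?I 0 (m', zs')" for m' zs'
      using that guard[OF that] by (simp add: loop_inv_def)
    show "?I n (m, zs)"
      using m width_le_mono[OF width_W W_L] by (simp add: loop_inv_def)
  qed
  then obtain u m' zs' where loop: "run (While_Pos (cell 1) level_step) (m, zs) u (m', zs')"
      "u \<le> n * (2 * L + D * L) + 2 * L" "?I 0 (m', zs')"
    by (metis surj_pair)
  obtain t where t: "t \<le> C * S" "run setup_cells (\<lambda>_. 0, inp) t (m, zs)"
    using init by blast
  have "run cutoff_program (\<lambda>_. 0, inp) (t + u) (m', zs')"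
    unfolding cutoff_program_def using t(2) loop(1) by (rule run.Seq)
  moreover have "t + u \<le> poly (time_bound C D) S"
  proof -
    have "poly (time_bound C D) S = C * S + S * ((D + 2) * L) + 2 * L"
      by (simp add: time_bound_def Let_def L_def W_def algebra_simps)
    moreover have "n * (2 * L + D * L) \<le> S * ((D + 2) * L)"
      using mult_le_mono1[OF n_S, of "(D + 2) * L"] by (simp add: algebra_simps)
    ultimately show ?thesis using t(1) loop(2) by linarith
  qed
  moreover have "m' 0 = ?k"
  proof -
    obtain c where "0 < c" "real (m 5) = c * a" "real (m 6) = c * (b - a)" using scale by blast
    then have "cutoff (frac_test (m 5) (m 6) (m 7) (m 8) n) n n = ?k"
      using m by (intro cutoff_cong frac_test_iff_worthwhile) auto
    then show ?thesis using loop(3) by (simp add: loop_inv_def)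
  qed
  ultimately show ?thesis unfolding computes_within_def inp_def S_def by blast
qed

theorem theorem1p1:
  "(\<forall>a b n F. iid_two_point a b n F \<longrightarrow>
      (\<exists>k\<le>n. discounted_revenue n F (\<lambda>_. b) (real k * b + real (n - k) * a) = Rev n F)) \<and>
   (\<exists>(c :: com) (q :: nat poly).
      \<forall>a b n F xss. iid_two_point a b n F \<and> length xss = n \<and> (\<forall>i<n. listing (xss ! i) (F i)) \<longrightarrow>
      (\<exists>k\<le>n. computes_within c (encode_instance xss) (poly q (input_size (encode_instance xss))) k \<and>
             discounted_revenue n F (\<lambda>_. b) (real k * b + real (n - k) * a) = Rev n F))"
proof -
  have optimal: "discounted_revenue n F (\<lambda>_. b) (real k * b + real (n - k) * a) = Rev n F"
    if "iid_two_point a b n F" "k = cutoff (two_point_iid.worthwhile a b n F) n n" for a b n F k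
  proof -
    interpret two_point_iid a b n F by unfold_locales fact
    show ?thesis using cutoff_optimal by (simp add: that(2) bundle_price_def)
  qed
  have "loop_free setup_cells"
    by (simp add: setup_cells_def load_input_def order_values_def)
  \<comment> \<open>\<open>C\<close> and \<open>D\<close> come from the program text before any
    instance is fixed, so one polynomial serves all instances.\<close>
  then obtain C where C: "\<And>s B. width_le B s \<Longrightarrow> width_le (C * B) (exec setup_cells s) \<and>
      (\<exists>t\<le>C * B. run setup_cells s t (exec setup_cells s))"
    using loop_free_run by blast
  have "loop_free level_step" by (simp add: level_step_def)
  then obtain D where D: "\<And>s B. width_le B s \<Longrightarrow> \<exists>t\<le>D * B. run level_step s t (exec level_step s)"
    using loop_free_run by blast
  have program: "\<exists>k\<le>n. computes_within cutoff_program (encode_instance xss)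
        (poly (time_bound C D) (input_size (encode_instance xss))) k \<and>
      discounted_revenue n F (\<lambda>_. b) (real k * b + real (n - k) * a) = Rev n F"
    if "iid_two_point a b n F" "length xss = n" "\<forall>i<n. listing (xss ! i) (F i)" for a b n F xss
    using cutoff_program_correct[OF C D two_point_iid.intro, of a b n F xss] optimal cutoff_le that
    by blast
  show ?thesis
  proof (intro conjI exI[of _ cutoff_program] exI[of _ "time_bound C D"] allI impI)
    fix a b n F assume "iid_two_point a b n F"
    then show "\<exists>k\<le>n. discounted_revenue n F (\<lambda>_. b) (real k * b + real (n - k) * a) = Rev n F"
      using optimal cutoff_le by blast
  qed (use program in blast)
qed

end
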